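(* Let $m\ge1$, and let $\nu_m$ be the product measure on $X$ and $Q$ its covariance operator described in the context. For every $\varphi\in C_b^1(X)$ and $z\in X$, $$\int_X\langle Q^{1/2}\nabla\varphi(x),z\rangle\,\nu_m(dx)=\int_X W_z^m(x)\,\varphi(x)\,\nu_m(dx),$$ where $$W_z^m(x):=b_{m,1}^{1/2}\sum_{h=1}^\infty\mu_h^{\frac1{2m}-1}|x_h|^{2m-2}x_hz_h,$$ the series being convergent in $L^p(X,\nu_m)$ for every $p\in(1,\infty)$. Consequently, for every $p>1$ and $z\in X$, $$\Big|\int_X\langle Q^{1/2}\nabla\varphi,z\rangle\,d\nu_m\Big|\le C_{p,z}\|\varphi\|_{L^p(X,\nu_m)},\qquad\varphi\in C_b^1(X),$$ with $C_{p,z}=\|W_z^m\|_{L^{p'}(X,\nu_m)}$, $p'=p/(p-1)$.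
   Context: $X$ is a separable infinite-dimensional real Hilbert space with a fixed orthonormal basis $\{e_h\}_{h\in\mathbb{N}}$; $x_h=\langle x,e_h\rangle$, and $X$ is identified with $\ell^2$ via $x\mapsto(x_h)$. $C_b^1(X)$ is the space of bounded continuously Fréchet differentiable functions with bounded gradient. For $\mu>0$, $m\ge1$, $\nu_{m,\mu}(d\xi)=a_m\mu^{-1/(2m)}e^{-|\xi|^{2m}/(2m\mu)}\,d\xi$ on $\mathbb{R}$, with $a_m=(2m)^{1-1/(2m)}/(2\Gamma(1/(2m)))$ the normalization constant making it a probability measure. $(\mu_h)_{h\in\mathbb{N}}$ is a sequence of positive numbers with $\sum_{h=1}^\infty\mu_h^{1/m}<\infty$, and $\nu_m=\prod_{h=1}^\infty\nu_{m,\mu_h}$, a product measure on $\mathbb{R}^\infty$ concentrated on $\ell^2\cong X$. Its covariance is $Qe_h=b_{m,1}\mu_h^{1/m}e_h$, $h\in\mathbb{N}$, with $b_{m,1}=(2m)^{1/m}\,\Gamma(3/(2m))/\Gamma(1/(2m))$. *)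

theory Defs
  imports "HOL-Probability.Probability"
begin

definition orthonormal_basis :: "(nat \<Rightarrow> 'a::real_inner) \<Rightarrow> bool" where
  "orthonormal_basis e \<longleftrightarrow>
     (\<forall>h k. e h \<bullet> e k = (if h = k then 1 else 0)) \<and> closure (span (range e)) = UNIV"

definition a_const :: "real \<Rightarrow> real" where
  "a_const m = (2 * m) powr (1 - 1 / (2 * m)) / (2 * Gamma (1 / (2 * m)))"

definition b_const :: "real \<Rightarrow> real" where
  "b_const m = (2 * m) powr (1 / m) * Gamma (3 / (2 * m)) / Gamma (1 / (2 * m))"

definition nu1 :: "real \<Rightarrow> real \<Rightarrow> real measure" where
  "nu1 m \<mu> = density lborel
     (\<lambda>\<xi>. ennreal (a_const m * \<mu> powr (- 1 / (2 * m)) * exp (- (\<bar>\<xi>\<bar> powr (2 * m)) / (2 * m * \<mu>))))"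

definition nu_seq :: "real \<Rightarrow> (nat \<Rightarrow> real) \<Rightarrow> (nat \<Rightarrow> real) measure" where
  "nu_seq m \<mu> = (\<Pi>\<^sub>M h\<in>UNIV. nu1 m (\<mu> h))"

text \<open>The product measure transported to the Hilbert space by the inverse of the identification
  of \<open>x\<close> with its coordinate sequence \<open>(x \<bullet> e h)\<^sub>h\<close>. That inverse is defined on the
  square-summable sequences only; these have full measure when \<open>\<mu> h powr (1/m)\<close> is summable,
  so the value chosen elsewhere is immaterial.\<close>

definition nu :: "real \<Rightarrow> (nat \<Rightarrow> real) \<Rightarrow> (nat \<Rightarrow> 'a::{real_inner,banach,second_countable_topology})
    \<Rightarrow> 'a measure" where
  "nu m \<mu> e = distr (nu_seq m \<mu>) borel
     (\<lambda>\<omega>. if summable (\<lambda>h. (\<omega> h)\<^sup>2) then (\<Sum>h. \<omega> h *\<^sub>R e h) else 0)"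

definition covariance_op :: "'a::{real_inner,banach,second_countable_topology} measure \<Rightarrow> 'a \<Rightarrow> 'a" where
  "covariance_op M = (THE Q. bounded_linear Q \<and>
     (\<forall>x y. Q x \<bullet> y =
        (\<integral>u. ((u - (\<integral>v. v \<partial>M)) \<bullet> x) * ((u - (\<integral>v. v \<partial>M)) \<bullet> y) \<partial>M)))"

definition op_sqrt :: "('a::real_inner \<Rightarrow> 'a) \<Rightarrow> 'a \<Rightarrow> 'a" where
  "op_sqrt Q = (THE R. bounded_linear R \<and> (\<forall>x y. R x \<bullet> y = x \<bullet> R y) \<and> (\<forall>x. 0 \<le> R x \<bullet> x)
     \<and> R \<circ> R = Q)"

definition grad :: "('a::real_inner \<Rightarrow> real) \<Rightarrow> 'a \<Rightarrow> 'a" where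
  "grad \<phi> x = (THE g. GDERIV \<phi> x :> g)"

definition Cb1 :: "('a::real_inner \<Rightarrow> real) set" where
  "Cb1 = {\<phi>. bounded (range \<phi>) \<and>
     (\<exists>\<phi>' :: 'a \<Rightarrow> 'a \<Rightarrow>\<^sub>L real.
        (\<forall>x. (\<phi> has_derivative blinfun_apply (\<phi>' x)) (at x)) \<and> continuous_on UNIV \<phi>') \<and>
     bounded (range (grad \<phi>))}"

definition Lp :: "'b measure \<Rightarrow> real \<Rightarrow> ('b \<Rightarrow> real) set" where
  "Lp M p = {f \<in> borel_measurable M. integrable M (\<lambda>x. \<bar>f x\<bar> powr p)}"

definition Lp_norm :: "'b measure \<Rightarrow> real \<Rightarrow> ('b \<Rightarrow> real) \<Rightarrow> real" where
  "Lp_norm M p f = (\<integral>x. \<bar>f x\<bar> powr p \<partial>M) powr (1 / p)"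

definition Lp_sums :: "'b measure \<Rightarrow> real \<Rightarrow> (nat \<Rightarrow> 'b \<Rightarrow> real) \<Rightarrow> ('b \<Rightarrow> real) \<Rightarrow> bool" where
  "Lp_sums M p f s \<longleftrightarrow> (\<forall>h. f h \<in> Lp M p) \<and> s \<in> Lp M p \<and>
     (\<lambda>n. Lp_norm M p (\<lambda>x. (\<Sum>h<n. f h x) - s x)) \<longlonglongrightarrow> 0"

definition W_term :: "real \<Rightarrow> (nat \<Rightarrow> real) \<Rightarrow> (nat \<Rightarrow> 'a::real_inner) \<Rightarrow> 'a \<Rightarrow> nat \<Rightarrow> 'a \<Rightarrow> real" where
  "W_term m \<mu> e z h x = sqrt (b_const m) *
     (\<mu> h powr (1 / (2 * m) - 1) * \<bar>x \<bullet> e h\<bar> powr (2 * m - 2) * (x \<bullet> e h) * (z \<bullet> e h))"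

text \<open>The series is understood in \<open>L\<^sup>p\<close>, so its sum \<open>W\<close> is determined only up to null sets;
  one function serves as the sum for all \<open>p\<close> simultaneously.\<close>

definition is_W :: "real \<Rightarrow> (nat \<Rightarrow> real) \<Rightarrow> (nat \<Rightarrow> 'a::{real_inner,banach,second_countable_topology})
    \<Rightarrow> 'a \<Rightarrow> ('a \<Rightarrow> real) \<Rightarrow> bool" where
  "is_W m \<mu> e z W \<longleftrightarrow> (\<forall>p>1. Lp_sums (nu m \<mu> e) p (W_term m \<mu> e z) W)"

end

theory Submission
  imports Defs "HOL-Real_Asymp.Real_Asymp"
begin

text \<open>
  Let \<open>Y h\<close> be the normalised score of the \<open>h\<close>-th coordinate, that is \<open>\<mu> h powr (1 / (2 * m))\<close>
  times the negative logarithmic derivative of its density. Integration by parts on the line and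
  Fubini's theorem give
  \<open>\<mu> h powr (1 / (2 * m)) * (\<integral>x. grad \<phi> x \<bullet> e h \<partial>\<nu>) = (\<integral>x. \<phi> x * Y h x \<partial>\<nu>)\<close>
  (\<open>nu1_integration_by_parts\<close>, \<open>integration_by_parts_coord\<close>). The covariance is diagonal in the
  basis, with the variances of the coordinates as eigenvalues, and its positive square root is the
  diagonal operator with eigenvalues \<open>sqrt (b_const m) * \<mu> h powr (1 / (2 * m))\<close>
  (\<open>op_sqrt_covariance_op\<close>). So the required formula is the combination of the coordinate formulas
  with the coefficients \<open>sqrt (b_const m) * (z \<bullet> e h)\<close>, and the series defining \<open>W\<close> is the
  corresponding combination of the \<open>Y h\<close>.

  The convergence of that series in all \<open>L\<^sup>p\<close> rests on the fact that the \<open>Y h\<close> are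
  independent, centred and, by scaling, identically distributed, with finite exponential moments:
  the score grows like \<open>\<bar>t\<bar> powr (2 * m - 1)\<close>, slower than the exponent in the density. Hence
  \<open>E (exp (l * Y h)) \<le> exp (c * l\<^sup>2)\<close> for \<open>\<bar>l\<bar> \<le> 1\<close> with one constant \<open>c\<close>
  (\<open>score_mgf_bound\<close>). Multiplying these bounds, a finite combination of the \<open>Y h\<close> divided by the
  \<open>\<ell>\<^sup>2\<close>-norm of its coefficients has exponential moments bounded by a constant, so its
  \<open>p\<close>-th absolute moment is at most a constant times the \<open>p\<close>-th power of that norm
  (\<open>moment_bound\<close>). As \<open>z\<close> has square-summable coordinates, the partial sums are Cauchy in
  every \<open>L\<^sup>p\<close>, with a common limit (\<open>ex_Lp_limit\<close>). The final estimate is Hoelder's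
  inequality.
\<close>

section \<open>Orthonormal bases and diagonal operators\<close>

lemma orthonormal_inner: "orthonormal_basis e \<Longrightarrow> e h \<bullet> e k = (if h = k then 1 else 0)"
  by (simp add: orthonormal_basis_def)

text \<open>Continuous linear maps agree as soon as they agree on the basis, whose span is dense. Every
  identification of an operator below is reduced to basis vectors in this way.\<close>

lemma bounded_linear_eqI_on_basis:
  fixes f g :: "'a::real_inner \<Rightarrow> 'b::real_normed_vector"
  assumes "orthonormal_basis e" "bounded_linear f" "bounded_linear g" "\<And>h. f (e h) = g (e h)"
  shows "f = g"
proof
  fix x
  interpret f: bounded_linear f by fact
  interpret g: bounded_linear g by fact
  have lf: "linear f" and lg: "linear g"
    using f.linear_axioms g.linear_axioms by auto
  have "span (range e) \<subseteq> {x. f x = g x}"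
  proof
    fix x assume "x \<in> span (range e)"
    then show "x \<in> {x. f x = g x}"
      using linear_eq_on_span[OF lf lg, of "range e" x] assms(4) by auto
  qed
  moreover have "closed {x. f x = g x}"
    by (intro closed_Collect_eq f.continuous_on g.continuous_on continuous_on_id)
  ultimately have "closure (span (range e)) \<subseteq> {x. f x = g x}"
    by (rule closure_minimal)
  then show "f x = g x"
    using assms(1) by (auto simp: orthonormal_basis_def)
qed

lemma basis_inner_eqI:
  assumes "orthonormal_basis e" "\<And>h. x \<bullet> e h = y \<bullet> e h"
  shows "x = y"
proof -
  have "(\<lambda>v. x \<bullet> v) = (\<lambda>v. y \<bullet> v)"
    using assms by (intro bounded_linear_eqI_on_basis[OF assms(1)] bounded_linear_inner_right) auto
  then have "x \<bullet> (x - y) = y \<bullet> (x - y)" by metis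
  then have "(x - y) \<bullet> (x - y) = 0" by (simp add: inner_diff_left)
  then show ?thesis by simp
qed

lemma orthonormal_sum_inner:
  assumes "orthonormal_basis e" "finite A"
  shows "(\<Sum>h\<in>A. c h *\<^sub>R e h) \<bullet> e k = (if k \<in> A then c k else 0)"
  using assms by (simp add: inner_sum_left orthonormal_inner if_distrib cong: if_cong)

lemma orthonormal_sum_norm:
  assumes "orthonormal_basis e" "finite A"
  shows "(norm (\<Sum>h\<in>A. c h *\<^sub>R e h))\<^sup>2 = (\<Sum>h\<in>A. (c h)\<^sup>2)"
proof -
  have "(norm (\<Sum>h\<in>A. c h *\<^sub>R e h))\<^sup>2 = (\<Sum>k\<in>A. c k * ((\<Sum>h\<in>A. c h *\<^sub>R e h) \<bullet> e k))"
    by (simp add: power2_norm_eq_inner inner_sum_right)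
  also have "\<dots> = (\<Sum>k\<in>A. (c k)\<^sup>2)"
    by (intro sum.cong) (simp_all add: orthonormal_sum_inner[OF assms] power2_eq_square)
  finally show ?thesis .
qed

text \<open>Riesz--Fischer: by Pythagoras the Cauchy condition for the vector series is that of the
  series of squared coefficients.\<close>

lemma summable_orthonormal_series:
  fixes e :: "nat \<Rightarrow> 'a::{real_inner,banach}"
  assumes e: "orthonormal_basis e" and c: "summable (\<lambda>h. (c h)\<^sup>2)"
  shows "summable (\<lambda>h. c h *\<^sub>R e h)"
  unfolding summable_Cauchy
proof (intro allI impI)
  fix r :: real assume "r > 0"
  then have "r\<^sup>2 > 0" by simp
  then obtain N where N: "\<And>m n. m \<ge> N \<Longrightarrow> norm (\<Sum>h=m..<n. (c h)\<^sup>2) < r\<^sup>2"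
    using c unfolding summable_Cauchy by blast
  show "\<exists>N. \<forall>m\<ge>N. \<forall>n. norm (\<Sum>h=m..<n. c h *\<^sub>R e h) < r"
  proof (intro exI allI impI)
    fix m n assume "m \<ge> N"
    then have "(norm (\<Sum>h=m..<n. c h *\<^sub>R e h))\<^sup>2 < r\<^sup>2"
      using N[of m n] by (simp add: orthonormal_sum_norm[OF e])
    then show "norm (\<Sum>h=m..<n. c h *\<^sub>R e h) < r"
      using \<open>r > 0\<close> by (simp add: power_less_imp_less_base)
  qed
qed

lemma orthonormal_series_inner:
  fixes e :: "nat \<Rightarrow> 'a::{real_inner,banach}"
  assumes e: "orthonormal_basis e" and c: "summable (\<lambda>h. (c h)\<^sup>2)"
  shows "(\<Sum>h. c h *\<^sub>R e h) \<bullet> e k = c k"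
proof -
  have "(\<Sum>h. c h *\<^sub>R e h) \<bullet> e k = (\<Sum>h. (c h *\<^sub>R e h) \<bullet> e k)"
    using bounded_linear.suminf[OF bounded_linear_inner_left summable_orthonormal_series[OF e c]] by simp
  also have "\<dots> = (\<Sum>h. if h = k then c k else 0)"
    by (intro suminf_cong) (simp add: orthonormal_inner[OF e])
  also have "\<dots> = c k"
    using sums_unique[OF sums_single[of k c]] by (simp add: eq_commute cong: if_cong)
  finally show ?thesis .
qed

lemma bessel_inequality:
  assumes e: "orthonormal_basis e"
  shows "summable (\<lambda>h. (x \<bullet> e h)\<^sup>2)"
proof (rule summableI_nonneg_bounded)
  fix n
  let ?s = "\<Sum>h<n. (x \<bullet> e h) *\<^sub>R e h"
  have "x \<bullet> ?s = (\<Sum>h<n. (x \<bullet> e h)\<^sup>2)"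
    by (simp add: inner_sum_right power2_eq_square)
  moreover have "0 \<le> (norm (x - ?s))\<^sup>2" by simp
  ultimately show "(\<Sum>h<n. (x \<bullet> e h)\<^sup>2) \<le> (norm x)\<^sup>2"
    using orthonormal_sum_norm[OF e, of "{..<n}" "\<lambda>h. x \<bullet> e h"]
    by (simp add: power2_norm_eq_inner inner_diff_left inner_diff_right inner_commute)
qed simp

lemma basis_expansion:
  fixes e :: "nat \<Rightarrow> 'a::{real_inner,banach}"
  assumes e: "orthonormal_basis e"
  shows "(\<lambda>h. (x \<bullet> e h) *\<^sub>R e h) sums x"
proof -
  have "(\<Sum>h. (x \<bullet> e h) *\<^sub>R e h) = x"
    by (rule basis_inner_eqI[OF e]) (simp add: orthonormal_series_inner[OF e bessel_inequality[OF e]])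
  then show ?thesis
    using summable_sums[OF summable_orthonormal_series[OF e bessel_inequality[OF e, of x]]] by simp
qed

lemma parseval_sums:
  fixes e :: "nat \<Rightarrow> 'a::{real_inner,banach}"
  assumes e: "orthonormal_basis e"
  shows "(\<lambda>h. (x \<bullet> e h) * (y \<bullet> e h)) sums (x \<bullet> y)"
  using bounded_linear.sums[OF bounded_linear_inner_left basis_expansion[OF e], of x y]
  by (simp add: inner_commute)

definition diag_op :: "(nat \<Rightarrow> 'a::{real_inner,banach}) \<Rightarrow> (nat \<Rightarrow> real) \<Rightarrow> 'a \<Rightarrow> 'a" where
  "diag_op e s x = (\<Sum>h. (s h * (x \<bullet> e h)) *\<^sub>R e h)"

lemma summable_diag_coeffs:
  assumes e: "orthonormal_basis e" and s: "bounded (range s)"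
  shows "summable (\<lambda>h. (s h * (x \<bullet> e h))\<^sup>2)"
proof -
  obtain B where B: "\<And>h. \<bar>s h\<bar> \<le> B"
    using s by (auto simp: bounded_iff)
  show ?thesis
  proof (rule summable_comparison_test')
    show "summable (\<lambda>h. B\<^sup>2 * (x \<bullet> e h)\<^sup>2)"
      by (intro summable_mult bessel_inequality e)
    show "norm ((s h * (x \<bullet> e h))\<^sup>2) \<le> B\<^sup>2 * (x \<bullet> e h)\<^sup>2" if "h \<ge> 0" for h
      using power_mono[OF B[of h], of 2] by (simp add: power_mult_distrib mult_right_mono)
  qed
qed

lemma diag_op_inner_basis:
  assumes "orthonormal_basis e" "bounded (range s)"
  shows "diag_op e s x \<bullet> e k = s k * (x \<bullet> e k)"
  unfolding diag_op_def by (rule orthonormal_series_inner[OF assms(1) summable_diag_coeffs[OF assms]])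

lemma diag_op_basis:
  assumes "orthonormal_basis e" "bounded (range s)"
  shows "diag_op e s (e k) = s k *\<^sub>R e k"
  by (rule basis_inner_eqI[OF assms(1)])
    (simp add: diag_op_inner_basis[OF assms] orthonormal_inner[OF assms(1)])

lemma diag_op_inner_sums:
  assumes "orthonormal_basis e" "bounded (range s)"
  shows "(\<lambda>h. s h * (x \<bullet> e h) * (y \<bullet> e h)) sums (diag_op e s x \<bullet> y)"
  using parseval_sums[OF assms(1), of "diag_op e s x" y] by (simp add: diag_op_inner_basis[OF assms])

lemma bounded_linear_diag_op:
  assumes e: "orthonormal_basis e" and s: "bounded (range s)"
  shows "bounded_linear (diag_op e s)"
proof -
  obtain B where B: "\<And>h. \<bar>s h\<bar> \<le> B"
    using s by (auto simp: bounded_iff)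
  show ?thesis
  proof (rule bounded_linear_intro)
    show "diag_op e s (x + y) = diag_op e s x + diag_op e s y" for x y
      by (rule basis_inner_eqI[OF e]) (simp add: diag_op_inner_basis[OF e s] inner_add_left algebra_simps)
    show "diag_op e s (r *\<^sub>R x) = r *\<^sub>R diag_op e s x" for r x
      by (rule basis_inner_eqI[OF e]) (simp add: diag_op_inner_basis[OF e s])
    show "norm (diag_op e s x) \<le> norm x * B" for x
    proof (rule power2_le_imp_le)
      have "(norm (diag_op e s x))\<^sup>2 \<le> B\<^sup>2 * (norm x)\<^sup>2"
        unfolding power2_norm_eq_inner
      proof (rule sums_le)
        show "(\<lambda>h. (diag_op e s x \<bullet> e h) * (diag_op e s x \<bullet> e h)) sums (diag_op e s x \<bullet> diag_op e s x)"
          by (rule parseval_sums[OF e])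
        show "(\<lambda>h. B\<^sup>2 * ((x \<bullet> e h) * (x \<bullet> e h))) sums (B\<^sup>2 * (x \<bullet> x))"
          by (intro sums_mult parseval_sums[OF e])
        show "diag_op e s x \<bullet> e h * (diag_op e s x \<bullet> e h) \<le> B\<^sup>2 * ((x \<bullet> e h) * (x \<bullet> e h))" for h
          using mult_right_mono[OF power_mono[OF B[of h], of 2], of "(x \<bullet> e h)\<^sup>2"]
          by (simp add: diag_op_inner_basis[OF e s] power2_eq_square algebra_simps)
      qed
      then show "(norm (diag_op e s x))\<^sup>2 \<le> (norm x * B)\<^sup>2"
        by (simp add: power_mult_distrib mult.commute)
      show "0 \<le> norm x * B" using B[of 0] by simp
    qed
  qed
qed

text \<open>Positive square roots are unique here because any positive \<open>R\<close> with
  \<open>R \<circ> R = diag_op e (\<lambda>h. (s h)\<^sup>2)\<close> is itself diagonal: the vector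
  \<open>y = R (e k) - s k *\<^sub>R e k\<close> satisfies \<open>R y = - s k *\<^sub>R y\<close>, which contradicts
  positivity unless \<open>y = 0\<close>.\<close>

lemma op_sqrt_diag_op:
  assumes e: "orthonormal_basis e" and s: "bounded (range s)" and pos: "\<And>h. s h > 0"
  shows "op_sqrt (diag_op e (\<lambda>h. (s h)\<^sup>2)) = diag_op e s"
proof -
  obtain B where B: "\<And>h. \<bar>s h\<bar> \<le> B"
    using s by (auto simp: bounded_iff)
  have s2: "bounded (range (\<lambda>h. (s h)\<^sup>2))"
    unfolding bounded_iff
    by (rule exI[of _ "B\<^sup>2"]) (use B in \<open>auto intro!: power2_le_iff_abs_le[THEN iffD2] order_trans[OF abs_ge_zero B]\<close>)
  show ?thesis
    unfolding op_sqrt_def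
  proof (rule the_equality, intro conjI allI)
    show "bounded_linear (diag_op e s)" by (rule bounded_linear_diag_op[OF e s])
    show "diag_op e s x \<bullet> y = x \<bullet> diag_op e s y" for x y
      using diag_op_inner_sums[OF e s, of x y] diag_op_inner_sums[OF e s, of y x]
      by (simp add: algebra_simps inner_commute sums_unique2)
    show "0 \<le> diag_op e s x \<bullet> x" for x
      by (rule sums_le[OF _ sums_zero diag_op_inner_sums[OF e s]])
        (simp add: pos less_imp_le mult.assoc)
    show "diag_op e s \<circ> diag_op e s = diag_op e (\<lambda>h. (s h)\<^sup>2)"
    proof
      show "(diag_op e s \<circ> diag_op e s) x = diag_op e (\<lambda>h. (s h)\<^sup>2) x" for x
        by (rule basis_inner_eqI[OF e])
          (simp add: diag_op_inner_basis[OF e s] diag_op_inner_basis[OF e s2], simp add: power2_eq_square)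
    qed
  next
    fix R assume *: "bounded_linear R \<and> (\<forall>x y. R x \<bullet> y = x \<bullet> R y) \<and> (\<forall>x. 0 \<le> R x \<bullet> x)
      \<and> R \<circ> R = diag_op e (\<lambda>h. (s h)\<^sup>2)"
    then interpret R: bounded_linear R by simp
    show "R = diag_op e s"
    proof (rule bounded_linear_eqI_on_basis[OF e R.bounded_linear_axioms bounded_linear_diag_op[OF e s]])
      fix k
      define y where "y = R (e k) - s k *\<^sub>R e k"
      have "R (R (e k)) = diag_op e (\<lambda>h. (s h)\<^sup>2) (e k)"
        using * by (metis comp_apply)
      then have "R y = - (s k *\<^sub>R y)"
        by (simp add: y_def R.diff R.scaleR diag_op_basis[OF e s2], simp add: power2_eq_square algebra_simps)
      moreover have "0 \<le> R y \<bullet> y" using * by blast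
      ultimately have "s k * (y \<bullet> y) \<le> 0" by simp
      then have "y = 0"
        using pos[of k] inner_ge_zero[of y] by (simp add: mult_le_0_iff)
      then show "R (e k) = diag_op e s (e k)"
        by (simp add: y_def diag_op_basis[OF e s])
    qed
  qed
qed

text \<open>The Riesz representation, with the representing vector built from its coordinates
  \<open>L (e h)\<close>. Applying \<open>L\<close> to the partial sums of \<open>\<Sum>h. L (e h) *\<^sub>R e h\<close> bounds their squared norm
  by a multiple of their norm, which makes the coordinates square-summable.\<close>

lemma riesz_representation:
  fixes e :: "nat \<Rightarrow> 'a::{real_inner,banach}"
  assumes e: "orthonormal_basis e" and L: "bounded_linear (L :: 'a \<Rightarrow> real)"
  obtains g where "\<And>x. L x = x \<bullet> g"
proof -
  interpret L: bounded_linear L by fact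
  obtain K where K: "K \<ge> 0" "\<And>x. norm (L x) \<le> norm x * K"
    using L.nonneg_bounded by blast
  have "summable (\<lambda>h. (L (e h))\<^sup>2)"
  proof (rule summableI_nonneg_bounded)
    fix n
    let ?S = "\<Sum>h<n. (L (e h))\<^sup>2"
    have S0: "?S \<ge> 0" by (simp add: sum_nonneg)
    have "?S = L (\<Sum>h<n. L (e h) *\<^sub>R e h)"
      by (simp add: L.sum L.scaleR power2_eq_square)
    also have "\<dots> \<le> norm (\<Sum>h<n. L (e h) *\<^sub>R e h) * K"
      using K(2)[of "\<Sum>h<n. L (e h) *\<^sub>R e h"] by simp
    finally have "?S\<^sup>2 \<le> (norm (\<Sum>h<n. L (e h) *\<^sub>R e h) * K)\<^sup>2"
      using S0 by (rule power_mono)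
    then have "?S * ?S \<le> ?S * K\<^sup>2"
      by (simp add: power_mult_distrib orthonormal_sum_norm[OF e] power2_eq_square[of ?S])
    then show "?S \<le> K\<^sup>2"
      using S0 by (cases "?S = 0") auto
  qed simp
  then have "L = (\<lambda>x. x \<bullet> (\<Sum>h. L (e h) *\<^sub>R e h))"
    by (intro bounded_linear_eqI_on_basis[OF e L bounded_linear_inner_left])
      (metis inner_commute orthonormal_series_inner[OF e])
  then have "L x = x \<bullet> (\<Sum>h. L (e h) *\<^sub>R e h)" for x by metis
  then show thesis by (rule that)
qed

section \<open>The one-dimensional laws\<close>

lemma nn_integral_even:
  fixes f :: "real \<Rightarrow> ennreal"
  assumes [measurable]: "f \<in> borel_measurable borel" and even: "\<And>t. f (- t) = f t"
  shows "(\<integral>\<^sup>+t. f t \<partial>lborel) = 2 * (\<integral>\<^sup>+t. indicator {0<..} t * f t \<partial>lborel)"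
proof -
  have "(\<integral>\<^sup>+t. f t \<partial>lborel) =
      (\<integral>\<^sup>+t. indicator {0<..} t * f t + indicator {..<0} t * f t \<partial>lborel)"
    using AE_lborel_singleton[of 0]
    by (intro nn_integral_cong_AE) (auto simp: indicator_def elim!: eventually_mono)
  also have "\<dots> = (\<integral>\<^sup>+t. indicator {0<..} t * f t \<partial>lborel) + (\<integral>\<^sup>+t. indicator {..<0} t * f t \<partial>lborel)"
    by (rule nn_integral_add) auto
  also have "(\<integral>\<^sup>+t. indicator {..<0} t * f t \<partial>lborel) = (\<integral>\<^sup>+t. indicator {0<..} t * f t \<partial>lborel)"
  proof -
    have "(\<integral>\<^sup>+t. indicator {..<0} t * f t \<partial>lborel) =
        ennreal \<bar>- 1\<bar> * (\<integral>\<^sup>+t. indicator {..<0} (0 + (- 1) * t) * f (0 + (- 1) * t) \<partial>lborel)"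
      by (rule nn_integral_real_affine) auto
    also have "\<dots> = (\<integral>\<^sup>+t. indicator {0<..} t * f t \<partial>lborel)"
      by (simp add: even) (simp add: indicator_def)
    finally show ?thesis .
  qed
  finally show ?thesis by (simp add: mult_2)
qed

text \<open>Substituting \<open>u = t powr (2 * m) / (2 * m)\<close> turns the moments of the weight
  \<open>exp (- \<bar>t\<bar> powr (2 * m) / (2 * m))\<close> into values of the Gamma function.\<close>

lemma nn_integral_abs_powr_weight:
  fixes m s :: real
  assumes m: "m > 0" and s: "s > -1"
  shows "(\<integral>\<^sup>+t. ennreal (\<bar>t\<bar> powr s * exp (- (\<bar>t\<bar> powr (2 * m)) / (2 * m))) \<partial>lborel) =
    ennreal (2 * ((2 * m) powr ((s + 1) / (2 * m) - 1) * Gamma ((s + 1) / (2 * m))))"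
proof -
  define r where "r = (s + 1) / (2 * m)"
  have r: "r > 0" using m s by (simp add: r_def)
  define g where "g t = t powr (2 * m) / (2 * m)" for t :: real
  define f where "f u = (2 * m) powr (r - 1) * (u powr (r - 1) / exp u)" for u :: real
  have img: "g ` {0<..} = {0<..}"
  proof (intro equalityI subsetI)
    fix u :: real assume u: "u \<in> {0<..}"
    have "u = g ((2 * m * u) powr (1 / (2 * m)))"
      using u m by (simp add: g_def powr_powr)
    moreover have "(2 * m * u) powr (1 / (2 * m)) \<in> {0<..}" using u m by simp
    ultimately show "u \<in> g ` {0<..}" by (rule image_eqI)
  qed (use m in \<open>auto simp: g_def\<close>)
  have inj: "inj_on g {0<..}"
  proof (rule inj_onI)
    fix x y :: real assume "x \<in> {0<..}" "y \<in> {0<..}" "g x = g y"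
    then have "(x powr (2 * m)) powr (1 / (2 * m)) = (y powr (2 * m)) powr (1 / (2 * m))"
      using m by (simp add: g_def)
    then show "x = y" using m \<open>x \<in> {0<..}\<close> \<open>y \<in> {0<..}\<close> by (simp add: powr_powr)
  qed
  have der: "(g has_field_derivative t powr (2 * m - 1)) (at t within {0<..})" if "t \<in> {0<..}" for t
    unfolding g_def using that m by (auto intro!: derivative_eq_intros)
  have fint: "(f has_integral (2 * m) powr (r - 1) * Gamma r) {0<..}"
  proof -
    have "(f has_integral (2 * m) powr (r - 1) * Gamma r) {0..}"
      unfolding f_def by (intro has_integral_mult_right Gamma_integral_real r)
    then show ?thesis
    proof (rule has_integral_spike_set_eq[THEN iffD1, rotated -1])
      show "negligible {t \<in> {0..} - {0<..}. f t \<noteq> 0}"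
        by (rule negligible_subset[of "{0}"]) auto
      show "negligible {t \<in> {0<..} - {0..}. f t \<noteq> 0}"
        by (rule negligible_subset[of "{0}"]) auto
    qed
  qed
  have "f absolutely_integrable_on {0<..}"
    using fint by (intro nonnegative_absolutely_integrable_1) (auto simp: f_def)
  then have "(\<lambda>t. \<bar>t powr (2 * m - 1)\<bar> * f (g t)) absolutely_integrable_on {0<..} \<and>
      integral {0<..} (\<lambda>t. \<bar>t powr (2 * m - 1)\<bar> * f (g t)) = (2 * m) powr (r - 1) * Gamma r"
    using has_absolute_integral_change_of_variables_1'[OF _ der inj,
        where f = f and b = "(2 * m) powr (r - 1) * Gamma r"] fint
    by (auto simp: img)
  then have "((\<lambda>t. \<bar>t powr (2 * m - 1)\<bar> * f (g t)) has_integral (2 * m) powr (r - 1) * Gamma r) {0<..}"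
    by (auto simp: has_integral_iff dest: set_lebesgue_integral_eq_integral(1))
  then have hi: "((\<lambda>t. \<bar>t\<bar> powr s * exp (- (\<bar>t\<bar> powr (2 * m)) / (2 * m)))
      has_integral (2 * m) powr (r - 1) * Gamma r) {0<..}"
  proof (rule has_integral_eq[rotated])
    fix t :: real assume t: "t \<in> {0<..}"
    have "(2 * m) powr (r - 1) * g t powr (r - 1) = t powr (2 * m * (r - 1))"
      using t m by (simp add: g_def powr_powr powr_divide)
    moreover have "t powr (2 * m - 1) * t powr (2 * m * (r - 1)) = t powr s"
      using m by (simp add: powr_add[symmetric] r_def field_simps)
    ultimately show "\<bar>t powr (2 * m - 1)\<bar> * f (g t) = \<bar>t\<bar> powr s * exp (- (\<bar>t\<bar> powr (2 * m)) / (2 * m))"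
      using t by (simp add: f_def g_def exp_minus field_simps)
  qed
  have "(\<integral>\<^sup>+t. indicator {0<..} t * ennreal (\<bar>t\<bar> powr s * exp (- (\<bar>t\<bar> powr (2 * m)) / (2 * m))) \<partial>lborel)
     = ennreal ((2 * m) powr (r - 1) * Gamma r)"
    using nn_integral_has_integral_lebesgue[OF _ hi]
    by (simp add: indicator_mult_ennreal)
  then show ?thesis
    by (subst nn_integral_even) (auto simp: r_def ennreal_mult' mult_ac)
qed

lemma sets_nu1 [simp, measurable_cong]: "sets (nu1 m \<mu>) = sets borel"
  by (simp add: nu1_def)

lemma space_nu1 [simp]: "space (nu1 m \<mu>) = UNIV"
  by (simp add: nu1_def)

lemma a_const_pos: "m > 0 \<Longrightarrow> a_const m > 0"
  by (simp add: a_const_def Gamma_real_pos)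

lemma b_const_pos: "m > 0 \<Longrightarrow> b_const m > 0"
  by (simp add: b_const_def Gamma_real_pos)

definition nu1_density :: "real \<Rightarrow> real \<Rightarrow> real \<Rightarrow> real" where
  "nu1_density m \<mu> t = a_const m * \<mu> powr (- 1 / (2 * m)) * exp (- (\<bar>t\<bar> powr (2 * m)) / (2 * m * \<mu>))"

lemma nu1_density_nonneg: "m > 0 \<Longrightarrow> 0 \<le> nu1_density m \<mu> t"
  by (simp add: nu1_density_def less_imp_le a_const_pos)

lemma measurable_nu1_density [measurable]: "nu1_density m \<mu> \<in> borel_measurable borel"
  by (simp add: nu1_density_def[abs_def])

lemma nu1_eq_density: "nu1 m \<mu> = density lborel (\<lambda>t. ennreal (nu1_density m \<mu> t))"
  by (simp add: nu1_def nu1_density_def)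

lemma nn_integral_nu1:
  "f \<in> borel_measurable borel \<Longrightarrow>
    (\<integral>\<^sup>+t. f t \<partial>nu1 m \<mu>) = (\<integral>\<^sup>+t. ennreal (nu1_density m \<mu> t) * f t \<partial>lborel)"
  unfolding nu1_eq_density by (rule nn_integral_density) auto

text \<open>All the laws are dilations of the one with parameter \<open>1\<close>, so that constants obtained for
  that law serve all coordinates at once.\<close>

lemma nu1_scaling:
  assumes m: "m > 0" and \<mu>: "\<mu> > 0"
  shows "nu1 m \<mu> = distr (nu1 m 1) borel (\<lambda>t. \<mu> powr (1 / (2 * m)) * t)"
proof (rule measure_eqI)
  fix A assume "A \<in> sets (nu1 m \<mu>)"
  then have [measurable]: "A \<in> sets borel" by simp
  let ?c = "\<mu> powr (1 / (2 * m))"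
  have c: "?c > 0" using \<mu> by simp
  have "emeasure (nu1 m \<mu>) A = (\<integral>\<^sup>+t. indicator A t \<partial>nu1 m \<mu>)" by simp
  also have "\<dots> = (\<integral>\<^sup>+t. ennreal (nu1_density m \<mu> t) * indicator A t \<partial>lborel)"
    by (rule nn_integral_nu1) simp
  also have "\<dots> = ennreal ?c * (\<integral>\<^sup>+t. ennreal (nu1_density m \<mu> (?c * t)) * indicator A (?c * t) \<partial>lborel)"
    using c by (subst nn_integral_real_affine[where c = "?c" and t = 0]) auto
  also have "\<dots> = (\<integral>\<^sup>+t. ennreal ?c * (ennreal (nu1_density m \<mu> (?c * t)) * indicator A (?c * t)) \<partial>lborel)"
    by (rule nn_integral_cmult[symmetric]) simp
  also have "\<dots> = (\<integral>\<^sup>+t. ennreal (nu1_density m 1 t) * indicator A (?c * t) \<partial>lborel)"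
  proof (rule nn_integral_cong)
    fix t :: real
    have "\<bar>?c * t\<bar> powr (2 * m) / (2 * m * \<mu>) = \<bar>t\<bar> powr (2 * m) / (2 * m)"
      using m \<mu> by (simp add: abs_mult powr_mult powr_powr)
    moreover have "?c * \<mu> powr (- 1 / (2 * m)) = 1"
      using \<mu> by (simp add: powr_add[symmetric])
    ultimately have "?c * nu1_density m \<mu> (?c * t) = nu1_density m 1 t"
      by (simp add: nu1_density_def mult_ac)
    then show "ennreal ?c * (ennreal (nu1_density m \<mu> (?c * t)) * indicator A (?c * t)) =
        ennreal (nu1_density m 1 t) * indicator A (?c * t)"
      using nu1_density_nonneg[OF m] c by (simp add: mult.assoc[symmetric] ennreal_mult'[symmetric])
  qed
  also have "\<dots> = (\<integral>\<^sup>+t. indicator A (?c * t) \<partial>nu1 m 1)"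
    by (rule nn_integral_nu1[symmetric]) simp
  also have "\<dots> = (\<integral>\<^sup>+t. indicator A t \<partial>distr (nu1 m 1) borel (\<lambda>t. ?c * t))"
    by (subst nn_integral_distr) auto
  finally show "emeasure (nu1 m \<mu>) A = emeasure (distr (nu1 m 1) borel (\<lambda>t. ?c * t)) A" by simp
qed simp

lemma prob_space_nu1_one:
  assumes m: "m > 0"
  shows "prob_space (nu1 m 1)"
proof
  have a_pos: "0 \<le> a_const m" using a_const_pos[OF m] by simp
  have "(\<integral>\<^sup>+t. ennreal (nu1_density m 1 t) \<partial>lborel) =
      ennreal (a_const m) * (\<integral>\<^sup>+t. ennreal (\<bar>t\<bar> powr 0 * exp (- (\<bar>t\<bar> powr (2 * m)) / (2 * m))) \<partial>lborel)"
    using AE_lborel_singleton[of 0]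
    by (subst nn_integral_cmult[symmetric])
      (auto simp: nu1_density_def a_pos ennreal_mult'[symmetric]
        intro!: nn_integral_cong_AE elim!: eventually_mono)
  also have "\<dots> = ennreal (a_const m * (2 * ((2 * m) powr (1 / (2 * m) - 1) * Gamma (1 / (2 * m)))))"
    using m a_pos by (subst nn_integral_abs_powr_weight) (auto simp: ennreal_mult'[symmetric])
  also have "a_const m * (2 * ((2 * m) powr (1 / (2 * m) - 1) * Gamma (1 / (2 * m)))) = 1"
  proof -
    have "(2 * m) powr (1 - 1 / (2 * m)) * (2 * m) powr (1 / (2 * m) - 1) = 1"
      using m by (simp add: powr_add[symmetric])
    then show ?thesis
      using m Gamma_real_pos[of "1 / (2 * m)"] by (simp add: a_const_def less_imp_neq[symmetric])
  qed
  finally show "emeasure (nu1 m 1) (space (nu1 m 1)) = 1"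
    using nn_integral_nu1[of "\<lambda>_. 1" m 1] by simp
qed

lemma prob_space_nu1:
  assumes m: "m > 0" and \<mu>: "\<mu> > 0"
  shows "prob_space (nu1 m \<mu>)"
  unfolding nu1_scaling[OF assms]
  by (rule prob_space.prob_space_distr[OF prob_space_nu1_one[OF m]]) simp

lemma nn_integral_nu1_square:
  assumes m: "m > 0" and \<mu>: "\<mu> > 0"
  shows "(\<integral>\<^sup>+t. ennreal (t\<^sup>2) \<partial>nu1 m \<mu>) = ennreal (b_const m * \<mu> powr (1 / m))"
proof -
  have a_pos: "0 \<le> a_const m" using a_const_pos[OF m] by simp
  have "(\<integral>\<^sup>+t. ennreal (t\<^sup>2) \<partial>nu1 m 1) =
      ennreal (a_const m) * (\<integral>\<^sup>+t. ennreal (\<bar>t\<bar> powr 2 * exp (- (\<bar>t\<bar> powr (2 * m)) / (2 * m))) \<partial>lborel)"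
  proof (subst nn_integral_cmult[symmetric], simp, subst nn_integral_nu1, simp, rule nn_integral_cong)
    fix t :: real
    show "ennreal (nu1_density m 1 t) * ennreal (t\<^sup>2) =
      ennreal (a_const m) * ennreal (\<bar>t\<bar> powr 2 * exp (- (\<bar>t\<bar> powr (2 * m)) / (2 * m)))"
      using a_pos by (simp add: nu1_density_def ennreal_mult''[symmetric] mult.assoc mult.commute)
  qed
  also have "\<dots> = ennreal (a_const m * (2 * ((2 * m) powr (3 / (2 * m) - 1) * Gamma (3 / (2 * m)))))"
    using m a_pos by (subst nn_integral_abs_powr_weight) (auto simp: ennreal_mult'[symmetric])
  also have "a_const m * (2 * ((2 * m) powr (3 / (2 * m) - 1) * Gamma (3 / (2 * m)))) = b_const m"
  proof -
    have "1 - 1 / (2 * m) + (3 / (2 * m) - 1) = 1 / m"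
      using m by (simp add: field_simps)
    then have "(2 * m) powr (1 - 1 / (2 * m)) * (2 * m) powr (3 / (2 * m) - 1) = (2 * m) powr (1 / m)"
      by (simp only: powr_add[symmetric])
    then show ?thesis
      by (simp add: a_const_def b_const_def)
  qed
  finally have one: "(\<integral>\<^sup>+t. ennreal (t\<^sup>2) \<partial>nu1 m 1) = ennreal (b_const m)" .
  have "(\<mu> powr (1 / (2 * m)))\<^sup>2 = \<mu> powr (1 / m)"
    using \<mu> by (simp add: powr_power)
  then have "(\<integral>\<^sup>+t. ennreal (t\<^sup>2) \<partial>nu1 m \<mu>) = (\<integral>\<^sup>+t. ennreal (\<mu> powr (1 / m)) * ennreal (t\<^sup>2) \<partial>nu1 m 1)"
    unfolding nu1_scaling[OF assms]
    by (subst nn_integral_distr) (auto simp: power_mult_distrib ennreal_mult')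
  also have "\<dots> = ennreal (\<mu> powr (1 / m)) * ennreal (b_const m)"
    by (simp add: nn_integral_cmult one)
  finally show ?thesis
    by (simp add: ennreal_mult'' mult.commute b_const_pos[OF m] less_imp_le)
qed

lemma integral_nu1_square:
  assumes m: "m > 0" and \<mu>: "\<mu> > 0"
  shows "(\<integral>t. t\<^sup>2 \<partial>nu1 m \<mu>) = b_const m * \<mu> powr (1 / m)"
  using nn_integral_nu1_square[OF assms] b_const_pos[OF m]
  by (simp add: integral_eq_nn_integral)

lemma integral_nu1_id:
  assumes m: "m > 0"
  shows "(\<integral>t. t \<partial>nu1 m \<mu>) = 0"
proof -
  have *: "(\<integral>t. t \<partial>nu1 m \<mu>) = (\<integral>t. nu1_density m \<mu> t * t \<partial>lborel)"
    unfolding nu1_eq_density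
    by (subst integral_density) (auto simp: nu1_density_nonneg m)
  also have "\<dots> = (\<integral>t. nu1_density m \<mu> (- t) * (- t) \<partial>lborel)"
    by (subst lborel_integral_real_affine[where c = "-1" and t = 0]) auto
  also have "\<dots> = - (\<integral>t. nu1_density m \<mu> t * t \<partial>lborel)"
    by (simp add: nu1_density_def)
  finally show ?thesis using * by simp
qed

text \<open>The negative logarithmic derivative of the density of \<open>nu1 m \<mu>\<close>, normalised by
  \<open>\<mu> powr (1 / (2 * m))\<close> so that its law does not depend on \<open>\<mu>\<close>.\<close>

definition score :: "real \<Rightarrow> real \<Rightarrow> real \<Rightarrow> real" where
  "score m \<mu> t = \<mu> powr (1 / (2 * m) - 1) * \<bar>t\<bar> powr (2 * m - 2) * t"

lemma measurable_score [measurable]: "score m \<mu> \<in> borel_measurable borel"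
  by (simp add: score_def[abs_def])

text \<open>This cancellation of powers of \<open>\<mu>\<close> is what makes the normalised scores of all coordinates
  identically distributed.\<close>

lemma score_scaling:
  assumes "m > 0" "\<mu> > 0"
  shows "score m \<mu> (\<mu> powr (1 / (2 * m)) * t) = score m 1 t"
proof -
  have "1 / (2 * m) - 1 + (1 / (2 * m)) * (2 * m - 2) + 1 / (2 * m) = 0"
    using assms by (simp add: field_simps)
  then have "\<mu> powr (1 / (2 * m) - 1) * (\<mu> powr (1 / (2 * m))) powr (2 * m - 2) * \<mu> powr (1 / (2 * m)) = 1"
    using assms by (simp only: powr_powr powr_add[symmetric]) simp
  then have "(\<mu> powr (1 / (2 * m) - 1) * (\<mu> powr (1 / (2 * m))) powr (2 * m - 2) * \<mu> powr (1 / (2 * m))) *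
      (\<bar>t\<bar> powr (2 * m - 2) * t) = \<bar>t\<bar> powr (2 * m - 2) * t" by simp
  then show ?thesis
    using assms by (simp add: score_def abs_mult powr_mult mult_ac)
qed

lemma abs_score_one: "\<bar>score m 1 t\<bar> = \<bar>t\<bar> powr (2 * m - 1)"
proof (cases "t = 0")
  case False
  have "\<bar>t\<bar> powr (2 * m - 1) = \<bar>t\<bar> powr (2 * m - 2) * \<bar>t\<bar> powr 1"
    unfolding powr_add[symmetric] by simp
  then show ?thesis by (simp add: score_def abs_mult)
qed (simp add: score_def)

text \<open>The exponent \<open>p - 2\<close> may be negative or \<open>0\<close>; at \<open>t = 0\<close> the right-hand side is \<open>0\<close>
  because of the factor \<open>t\<close>, in agreement with the derivative for \<open>p > 1\<close>.\<close>

lemma has_real_derivative_abs_powr: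
  fixes p t :: real
  assumes p: "p > 1"
  shows "((\<lambda>t. \<bar>t\<bar> powr p) has_real_derivative p * (\<bar>t\<bar> powr (p - 2) * t)) (at t)"
proof -
  have pow: "\<bar>x\<bar> powr (p - 2) * \<bar>x\<bar> = \<bar>x\<bar> powr (p - 1)" if "x \<noteq> 0" for x :: real
    using that powr_add[of "\<bar>x\<bar>" "p - 2" 1] by simp
  consider "t > 0" | "t < 0" | "t = 0" by linarith
  then show ?thesis
  proof cases
    case 1
    have "((\<lambda>t. t powr p) has_real_derivative p * (\<bar>t\<bar> powr (p - 2) * t)) (at t)"
      using 1 pow[of t] by (auto intro!: derivative_eq_intros)
    then show ?thesis
      by (rule has_field_derivative_transform_within_open[where S = "{0<..}"]) (use 1 in auto)
  next
    case 2
    have "((\<lambda>t. (- t) powr p) has_real_derivative p * (\<bar>t\<bar> powr (p - 2) * t)) (at t)"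
    proof -
      have "\<bar>t\<bar> powr (p - 2) * t = - ((- t) powr (p - 1))"
        using 2 pow[of t] by simp
      then show ?thesis
        using 2 by (auto intro!: derivative_eq_intros)
    qed
    then show ?thesis
      by (rule has_field_derivative_transform_within_open[where S = "{..<0}"]) (use 2 in auto)
  next
    case 3
    have "((\<lambda>h. \<bar>h\<bar> powr (p - 1)) \<longlongrightarrow> 0) (at (0::real))"
      using p by (auto intro!: tendsto_eq_intros tendsto_powr'[where a = "0::real" and b = "p - 1", simplified])
    then have "((\<lambda>h. \<bar>h\<bar> powr p / h) \<longlongrightarrow> 0) (at (0::real))"
    proof (rule Lim_null_comparison[rotated])
      show "\<forall>\<^sub>F h in at 0. norm (\<bar>h\<bar> powr p / h) \<le> \<bar>h\<bar> powr (p - 1)"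
        by (auto simp: eventually_at_filter powr_diff abs_mult)
    qed
    then show ?thesis using 3 by (simp add: has_field_derivative_iff)
  qed
qed

lemma isCont_abs_powr_times:
  fixes p t :: real
  assumes p: "p > 1"
  shows "isCont (\<lambda>t. \<bar>t\<bar> powr (p - 2) * t) t"
proof (cases "t = 0")
  case False
  then show ?thesis by (intro continuous_intros) auto
next
  case True
  have "((\<lambda>h. \<bar>h\<bar> powr (p - 1)) \<longlongrightarrow> 0) (at (0::real))"
    using p by (auto intro!: tendsto_eq_intros tendsto_powr'[where a = "0::real" and b = "p - 1", simplified])
  then have "((\<lambda>h. \<bar>h\<bar> powr (p - 2) * h) \<longlongrightarrow> 0) (at (0::real))"
  proof (rule Lim_null_comparison[rotated])
    show "\<forall>\<^sub>F h in at 0. norm (\<bar>h\<bar> powr (p - 2) * h) \<le> \<bar>h\<bar> powr (p - 1)"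
    proof (intro always_eventually allI)
      show "norm (\<bar>h\<bar> powr (p - 2) * h) \<le> \<bar>h\<bar> powr (p - 1)" for h :: real
        using powr_add[of "\<bar>h\<bar>" "p - 2" 1] by (cases "h = 0") (auto simp: abs_mult)
    qed
  qed
  then show ?thesis using True by (simp add: isCont_def)
qed

lemma isCont_score: "m \<ge> 1 \<Longrightarrow> isCont (score m \<mu>) t"
  using isCont_abs_powr_times[of "2 * m" t]
  by (auto simp: score_def[abs_def] mult.assoc intro!: continuous_intros)

lemma nu1_density_deriv:
  assumes m: "m \<ge> 1" and \<mu>: "\<mu> > 0"
  shows "(nu1_density m \<mu> has_real_derivative
    - (\<mu> powr (- 1 / (2 * m)) * score m \<mu> t * nu1_density m \<mu> t)) (at t)"
proof -
  have "2 * m > 1" using m by simp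
  note D = has_real_derivative_abs_powr[OF this, of t]
  have "\<mu> powr (- 1 / (2 * m)) * \<mu> powr (1 / (2 * m) - 1) = inverse \<mu>"
    using \<mu> by (simp only: powr_add[symmetric]) (simp add: powr_minus)
  moreover have "\<mu> powr (- 1 / (2 * m)) * score m \<mu> t =
      (\<mu> powr (- 1 / (2 * m)) * \<mu> powr (1 / (2 * m) - 1)) * (\<bar>t\<bar> powr (2 * m - 2) * t)"
    by (simp only: score_def mult.assoc)
  ultimately have eq: "\<mu> powr (- 1 / (2 * m)) * score m \<mu> t = \<bar>t\<bar> powr (2 * m - 2) * t / \<mu>"
    by (simp only: divide_inverse mult.commute)
  show ?thesis
    unfolding eq unfolding nu1_density_def[abs_def]
    by (rule DERIV_cong[OF DERIV_cmult[OF DERIV_fun_exp[OF DERIV_cdivide[OF DERIV_minus[OF D]]]]])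
      (use m \<mu> in \<open>simp add: field_simps\<close>)
qed

text \<open>Exponential integrability of the score: its growth exponent \<open>2 * m - 1\<close> is smaller
  than the exponent \<open>2 * m\<close> in the density.\<close>

lemma integrable_exp_score_one:
  assumes m: "m \<ge> 1"
  shows "integrable (nu1 m 1) (\<lambda>t. exp (2 * \<bar>score m 1 t\<bar>))"
proof -
  have m0: "m > 0" using m by simp
  interpret N2: prob_space "nu1 m 2" by (rule prob_space_nu1) (use m0 in auto)
  have int2: "integrable lborel (nu1_density m 2)"
  proof -
    have "integrable (nu1 m 2) (\<lambda>t. 1::real)" by simp
    then show ?thesis
      unfolding nu1_eq_density by (subst (asm) integrable_density) (auto simp: nu1_density_nonneg m0)
  qed
  \<comment> \<open>Up to a constant, half of the exponent of the density absorbs twice the score, and the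
    remaining half is the exponent of the law with parameter \<open>2\<close>. The constant is the maximum of
    twice the score on \<open>\<bar>t\<bar> \<le> 8 * m\<close>; for larger \<open>\<bar>t\<bar>\<close> the power \<open>2 * m\<close> wins.\<close>
  define C where "C = 2 * (8 * m) powr (2 * m - 1)"
  have bnd: "2 * \<bar>score m 1 t\<bar> \<le> C + \<bar>t\<bar> powr (2 * m) / (4 * m)" for t
  proof (cases "\<bar>t\<bar> \<le> 8 * m")
    case True
    then have "\<bar>t\<bar> powr (2 * m - 1) \<le> (8 * m) powr (2 * m - 1)"
      using m by (intro powr_mono2) auto
    then show ?thesis
      using m0 by (simp add: abs_score_one C_def add_increasing2)
  next
    case False
    then have "8 * m * \<bar>t\<bar> powr (2 * m - 1) \<le> \<bar>t\<bar> * \<bar>t\<bar> powr (2 * m - 1)"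
      by (intro mult_right_mono) auto
    also have "\<bar>t\<bar> * \<bar>t\<bar> powr (2 * m - 1) = \<bar>t\<bar> powr (2 * m)"
      using powr_add[of "\<bar>t\<bar>" 1 "2 * m - 1"] False m0 by simp
    finally have "2 * \<bar>t\<bar> powr (2 * m - 1) \<le> \<bar>t\<bar> powr (2 * m) / (4 * m)"
      using m0 by (simp add: field_simps)
    moreover have "C \<ge> 0" by (simp add: C_def)
    ultimately show ?thesis by (simp add: abs_score_one)
  qed
  have "integrable lborel (\<lambda>t. nu1_density m 1 t *\<^sub>R exp (2 * \<bar>score m 1 t\<bar>))"
  proof (rule Bochner_Integration.integrable_bound)
    show "integrable lborel (\<lambda>t. exp C * 2 powr (1 / (2 * m)) * nu1_density m 2 t)"
      using int2 by simp
    show "AE t in lborel. norm (nu1_density m 1 t *\<^sub>R exp (2 * \<bar>score m 1 t\<bar>)) \<le>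
        norm (exp C * 2 powr (1 / (2 * m)) * nu1_density m 2 t)"
    proof (rule AE_I2)
      fix t
      have "exp (- (\<bar>t\<bar> powr (2 * m)) / (2 * m)) * exp (2 * \<bar>score m 1 t\<bar>) \<le>
          exp (- (\<bar>t\<bar> powr (2 * m)) / (2 * m)) * exp (C + \<bar>t\<bar> powr (2 * m) / (4 * m))"
        using bnd[of t] by simp
      also have "\<dots> = exp C * exp (- (\<bar>t\<bar> powr (2 * m)) / (2 * m * 2))"
        using m0 by (simp add: exp_add[symmetric] field_simps)
      finally have "a_const m * (exp (- (\<bar>t\<bar> powr (2 * m)) / (2 * m)) * exp (2 * \<bar>score m 1 t\<bar>)) \<le>
          a_const m * (exp C * exp (- (\<bar>t\<bar> powr (2 * m)) / (2 * m * 2)))"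
        using a_const_pos[OF m0] by simp
      moreover have "2 powr (1 / (2 * m)) * 2 powr (- 1 / (2 * m)) = (1::real)"
        by (simp add: powr_add[symmetric])
      ultimately show "norm (nu1_density m 1 t *\<^sub>R exp (2 * \<bar>score m 1 t\<bar>)) \<le>
          norm (exp C * 2 powr (1 / (2 * m)) * nu1_density m 2 t)"
        using a_const_pos[OF m0] by (simp add: nu1_density_def abs_mult mult_ac) (simp add: mult.assoc[symmetric])
    qed
  qed simp
  then show ?thesis
    unfolding nu1_eq_density by (subst integrable_density) (auto simp: nu1_density_nonneg m0)
qed

lemma integrable_score:
  assumes m: "m \<ge> 1" and \<mu>: "\<mu> > 0"
  shows "integrable (nu1 m \<mu>) (score m \<mu>)"
proof -
  have m0: "m > 0" using m by simp
  have "integrable (nu1 m 1) (score m 1)"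
  proof (rule Bochner_Integration.integrable_bound[OF integrable_exp_score_one[OF m]])
    show "AE t in nu1 m 1. norm (score m 1 t) \<le> norm (exp (2 * \<bar>score m 1 t\<bar>))"
    proof (rule AE_I2)
      show "norm (score m 1 t) \<le> norm (exp (2 * \<bar>score m 1 t\<bar>))" for t
        using exp_ge_add_one_self[of "2 * \<bar>score m 1 t\<bar>"] unfolding real_norm_def abs_exp_cancel by linarith
    qed
  qed simp
  then show ?thesis
    by (subst nu1_scaling[OF m0 \<mu>], subst integrable_distr_eq) (auto simp: score_scaling m0 \<mu>)
qed

lemma nu1_density_tendsto_0:
  assumes m: "m > 0" and \<mu>: "\<mu> > 0" and F: "filterlim (\<lambda>t::real. \<bar>t\<bar>) at_top F"
  shows "(nu1_density m \<mu> \<longlongrightarrow> 0) F"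
proof -
  have "filterlim (\<lambda>x::real. x powr (2 * m) / (2 * m * \<mu>)) at_top at_top"
    using m \<mu> by real_asymp
  from filterlim_compose[OF this F]
  have "filterlim (\<lambda>t. \<bar>t\<bar> powr (2 * m) / (2 * m * \<mu>)) at_top F" .
  then have "((\<lambda>t. exp (- (\<bar>t\<bar> powr (2 * m) / (2 * m * \<mu>)))) \<longlongrightarrow> 0) F"
    by (intro filterlim_compose[OF exp_at_bot]) (simp add: filterlim_uminus_at_bot)
  then have "((\<lambda>t. a_const m * \<mu> powr (- 1 / (2 * m)) * exp (- (\<bar>t\<bar> powr (2 * m) / (2 * m * \<mu>)))) \<longlongrightarrow> 0) F"
    by (rule tendsto_mult_right_zero)
  then show ?thesis by (simp add: nu1_density_def[abs_def])
qed

text \<open>Integration by parts on the line; the boundary terms vanish because \<open>g\<close> is bounded and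
  the density tends to \<open>0\<close>.\<close>

lemma nu1_integration_by_parts:
  assumes m: "m \<ge> 1" and \<mu>: "\<mu> > 0"
    and deriv: "\<And>t. (g has_real_derivative g' t) (at t)"
    and cont: "continuous_on UNIV g'"
    and bdd: "\<And>t. \<bar>g t\<bar> \<le> B" and bdd': "\<And>t. \<bar>g' t\<bar> \<le> B'"
  shows "\<mu> powr (1 / (2 * m)) * (\<integral>t. g' t \<partial>nu1 m \<mu>) = (\<integral>t. g t * score m \<mu> t \<partial>nu1 m \<mu>)"
proof -
  have m0: "m > 0" using m by simp
  interpret N: prob_space "nu1 m \<mu>" by (rule prob_space_nu1[OF m0 \<mu>])
  let ?\<rho> = "nu1_density m \<mu>" and ?k = "\<mu> powr (- 1 / (2 * m))"
  have contg: "continuous_on UNIV g"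
    using deriv by (meson DERIV_isCont continuous_at_imp_continuous_on)
  have [measurable]: "g \<in> borel_measurable borel" "g' \<in> borel_measurable borel"
    using cont contg by (auto intro: borel_measurable_continuous_onI)
  have i1: "integrable (nu1 m \<mu>) g'"
    by (rule N.integrable_const_bound[where B = B']) (auto simp: bdd')
  have i2: "integrable (nu1 m \<mu>) (\<lambda>t. g t * score m \<mu> t)"
    by (rule Bochner_Integration.integrable_bound[where f = "\<lambda>t. B * score m \<mu> t"])
      (auto intro!: integrable_score[OF m \<mu>] AE_I2 mult_right_mono order_trans[OF bdd] simp: abs_mult)
  define F where "F t = g t * ?\<rho> t" for t
  define f where "f t = ?\<rho> t * g' t - ?k * (?\<rho> t * (g t * score m \<mu> t))" for t
  have l1: "integrable lborel (\<lambda>t. ?\<rho> t * g' t)" "(\<integral>t. g' t \<partial>nu1 m \<mu>) = (\<integral>t. ?\<rho> t * g' t \<partial>lborel)"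
    using i1 unfolding nu1_eq_density
    by (auto simp: integrable_density integral_density nu1_density_nonneg m0)
  have l2: "integrable lborel (\<lambda>t. ?\<rho> t * (g t * score m \<mu> t))"
    "(\<integral>t. g t * score m \<mu> t \<partial>nu1 m \<mu>) = (\<integral>t. ?\<rho> t * (g t * score m \<mu> t) \<partial>lborel)"
    using i2 unfolding nu1_eq_density
    by (auto simp: integrable_density integral_density nu1_density_nonneg m0)
  have F': "(F has_vector_derivative f t) (at t)" for t
    unfolding has_real_derivative_iff_has_vector_derivative[symmetric] F_def f_def
    by (auto intro!: derivative_eq_intros deriv nu1_density_deriv[OF m \<mu>] simp: algebra_simps)
  have contf: "isCont f t" for t
    unfolding f_def
    by (intro continuous_intros isCont_score[OF m] DERIV_isCont[OF nu1_density_deriv[OF m \<mu>]]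
        DERIV_isCont[OF deriv] continuous_on_interior[OF cont]) auto
  have lim: "(F \<longlongrightarrow> 0) G" if "filterlim (\<lambda>t::real. \<bar>t\<bar>) at_top G" for G
  proof (rule Lim_null_comparison)
    show "\<forall>\<^sub>F t in G. norm (F t) \<le> B * ?\<rho> t"
      using bdd by (intro always_eventually) (auto simp: F_def abs_mult nu1_density_nonneg m0 intro!: mult_right_mono)
    show "((\<lambda>t. B * ?\<rho> t) \<longlongrightarrow> 0) G"
      by (intro tendsto_mult_right_zero nu1_density_tendsto_0 m0 \<mu> that)
  qed
  have "(LBINT t=-\<infinity>..\<infinity>. f t) = 0 - 0"
  proof (rule interval_integral_FTC_integrable[where F = F])
    show "set_integrable lborel (einterval (- \<infinity>) \<infinity>) f"
      using l1 l2 by (simp add: set_integrable_def f_def)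
    show "((F \<circ> real_of_ereal) \<longlongrightarrow> 0) (at_right (- \<infinity>))"
      unfolding ereal_tendsto_simps1 by (rule lim) real_asymp
    show "((F \<circ> real_of_ereal) \<longlongrightarrow> 0) (at_left \<infinity>)"
      unfolding ereal_tendsto_simps1 by (rule lim) real_asymp
  qed (auto simp: F' contf)
  then have "(\<integral>t. f t \<partial>lborel) = 0"
    by (simp add: interval_lebesgue_integral_def set_lebesgue_integral_def)
  then have "(\<integral>t. g' t \<partial>nu1 m \<mu>) = ?k * (\<integral>t. g t * score m \<mu> t \<partial>nu1 m \<mu>)"
    using l1 l2 by (simp add: f_def)
  moreover have "\<mu> powr (1 / (2 * m)) * ?k = 1"
    using \<mu> by (simp add: powr_add[symmetric])
  ultimately show ?thesis by (simp add: mult.assoc[symmetric])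
qed

text \<open>Taylor's formula with remainder. One factor \<open>exp \<bar>y\<bar>\<close> dominates the exponential in the
  remainder, the other one dominates \<open>y\<^sup>2 / 2\<close>.\<close>

lemma exp_le_quadratic:
  fixes y l :: real
  assumes l: "\<bar>l\<bar> \<le> 1"
  shows "exp (l * y) \<le> 1 + l * y + l\<^sup>2 * exp (2 * \<bar>y\<bar>)"
proof -
  obtain s where s: "\<bar>s\<bar> \<le> \<bar>l * y\<bar>" "exp (l * y) = (\<Sum>i<2. (l * y) ^ i / fact i) + exp s / fact 2 * (l * y) ^ 2"
    using Maclaurin_exp_le by blast
  have "s \<le> \<bar>y\<bar>"
    using s(1) l mult_right_mono[OF l, of "\<bar>y\<bar>"] by (simp add: abs_mult)
  moreover have "y\<^sup>2 / 2 \<le> exp \<bar>y\<bar>"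
    using exp_lower_Taylor_quadratic[of "\<bar>y\<bar>"] by simp
  ultimately have "exp s * (y\<^sup>2 / 2) \<le> exp \<bar>y\<bar> * exp \<bar>y\<bar>"
    by (intro mult_mono) auto
  also have "\<dots> = exp (2 * \<bar>y\<bar>)" by (simp add: exp_add[symmetric])
  finally have "l\<^sup>2 * (exp s * (y\<^sup>2 / 2)) \<le> l\<^sup>2 * exp (2 * \<bar>y\<bar>)"
    by (intro mult_left_mono) auto
  then show ?thesis
    using s(2) by (simp add: numeral_2_eq_2 power_mult_distrib mult_ac)
qed

text \<open>The score is centred and has exponential moments, hence the logarithm of its moment
  generating function is at most quadratic near the origin.\<close>

lemma score_mgf_bound:
  assumes m: "m \<ge> 1"
  obtains c :: real where "c \<ge> 0"
    "\<And>\<mu> l. \<mu> > 0 \<Longrightarrow> \<bar>l\<bar> \<le> 1 \<Longrightarrow> (\<integral>\<^sup>+t. ennreal (exp (l * score m \<mu> t)) \<partial>nu1 m \<mu>) \<le> ennreal (exp (c * l\<^sup>2))"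
proof -
  have m0: "m > 0" using m by simp
  interpret N: prob_space "nu1 m 1" by (rule prob_space_nu1_one[OF m0])
  define c where "c = (\<integral>t. exp (2 * \<bar>score m 1 t\<bar>) \<partial>nu1 m 1)"
  \<comment> \<open>integration by parts against a constant\<close>
  have mean: "(\<integral>t. score m 1 t \<partial>nu1 m 1) = 0"
    using nu1_integration_by_parts[OF m, of 1 "\<lambda>_. 1" "\<lambda>_. 0" 1 0] by simp
  have c0: "c \<ge> 0" unfolding c_def by (rule integral_nonneg_AE) simp
  have "(\<integral>\<^sup>+t. ennreal (exp (l * score m \<mu> t)) \<partial>nu1 m \<mu>) \<le> ennreal (exp (c * l\<^sup>2))"
    if \<mu>: "\<mu> > 0" and l: "\<bar>l\<bar> \<le> 1" for \<mu> l
  proof -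
    let ?q = "\<lambda>t. 1 + l * score m 1 t + l\<^sup>2 * exp (2 * \<bar>score m 1 t\<bar>)"
    have q0: "0 \<le> ?q t" for t
      using exp_le_quadratic[OF l, of "score m 1 t"] exp_gt_zero[of "l * score m 1 t"] by linarith
    have iq: "integrable (nu1 m 1) ?q"
      using integrable_score[OF m, of 1] integrable_exp_score_one[OF m] by auto
    have q: "(\<integral>t. ?q t \<partial>nu1 m 1) = 1 + l\<^sup>2 * c"
      using integrable_score[OF m, of 1] integrable_exp_score_one[OF m] N.prob_space mean
      by (simp add: c_def)
    have "(\<integral>\<^sup>+t. ennreal (exp (l * score m \<mu> t)) \<partial>nu1 m \<mu>) = (\<integral>\<^sup>+t. ennreal (exp (l * score m 1 t)) \<partial>nu1 m 1)"
      by (subst nu1_scaling[OF m0 \<mu>], subst nn_integral_distr) (auto simp: score_scaling m0 \<mu>)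
    also have "\<dots> \<le> (\<integral>\<^sup>+t. ennreal (?q t) \<partial>nu1 m 1)"
      by (intro nn_integral_mono ennreal_leI exp_le_quadratic l)
    also have "\<dots> = ennreal (\<integral>t. ?q t \<partial>nu1 m 1)"
      by (rule nn_integral_eq_integral[OF iq]) (simp add: q0)
    also have "\<dots> = ennreal (1 + l\<^sup>2 * c)" by (simp only: q)
    also have "\<dots> \<le> ennreal (exp (c * l\<^sup>2))"
      using exp_ge_add_one_self[of "c * l\<^sup>2"] by (intro ennreal_leI) (simp add: mult.commute)
    finally show ?thesis .
  qed
  with c0 show thesis by (rule that)
qed

section \<open>The product measure on the Hilbert space\<close>

locale hilbert_product_measure =
  fixes m :: real and \<mu> :: "nat \<Rightarrow> real"
    and e :: "nat \<Rightarrow> 'a::{real_inner,banach,second_countable_topology}"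
  assumes m: "m \<ge> 1" and e: "orthonormal_basis e" and \<mu>: "\<And>h. \<mu> h > 0"
    and summable_\<mu>: "summable (\<lambda>h. \<mu> h powr (1 / m))"
begin

abbreviation (input) \<nu>seq :: "(nat \<Rightarrow> real) measure" where "\<nu>seq \<equiv> nu_seq m \<mu>"
abbreviation (input) \<nu> :: "'a measure" where "\<nu> \<equiv> nu m \<mu> e"

definition synth :: "(nat \<Rightarrow> real) \<Rightarrow> 'a" where
  "synth \<omega> = (if summable (\<lambda>h. (\<omega> h)\<^sup>2) then (\<Sum>h. \<omega> h *\<^sub>R e h) else 0)"

lemma nu_eq: "\<nu> = distr \<nu>seq borel synth"
  by (simp add: nu_def synth_def[abs_def])

lemma m_pos: "m > 0" using m by simp

lemma sets_nu_seq [measurable_cong]: "sets \<nu>seq = sets (PiM UNIV (\<lambda>_. borel))"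
  unfolding nu_seq_def by (intro sets_PiM_cong) auto

lemma space_nu_seq [simp]: "space \<nu>seq = UNIV"
  by (simp add: nu_seq_def space_PiM)

lemma sets_nu [simp, measurable_cong]: "sets \<nu> = sets borel"
  by (simp add: nu_def)

lemma space_nu [simp]: "space \<nu> = UNIV"
  by (simp add: nu_def)

lemma measurable_nu_iff [simp]: "f \<in> measurable \<nu> N \<longleftrightarrow> f \<in> measurable borel N"
  by (simp add: measurable_cong_sets[OF sets_nu refl])

lemma prob_space_nu1_coord: "prob_space (nu1 m (\<mu> h))"
  by (rule prob_space_nu1[OF m_pos \<mu>])

sublocale seq: prob_space \<nu>seq
  unfolding nu_seq_def by (intro prob_space_PiM prob_space_nu1_coord)

lemma measurable_coord [measurable]: "(\<lambda>\<omega>. \<omega> h) \<in> borel_measurable (PiM UNIV (\<lambda>_. borel))"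
  by (rule measurable_component_singleton) simp

lemma measurable_coord_nu_seq [measurable]: "(\<lambda>\<omega>. \<omega> h) \<in> borel_measurable \<nu>seq"
  unfolding measurable_cong_sets[OF sets_nu_seq refl] by (rule measurable_coord)

lemma distr_nu_seq_coord: "distr \<nu>seq borel (\<lambda>\<omega>. \<omega> h) = nu1 m (\<mu> h)"
proof -
  have "distr \<nu>seq borel (\<lambda>\<omega>. \<omega> h) = distr \<nu>seq (nu1 m (\<mu> h)) (\<lambda>\<omega>. \<omega> h)"
    by (rule distr_cong) auto
  also have "\<dots> = nu1 m (\<mu> h)"
    unfolding nu_seq_def by (rule distr_PiM_component[OF prob_space_nu1_coord]) simp
  finally show ?thesis .
qed

lemma summable_iff_suminf_ennreal:
  "summable (\<lambda>h. ((\<omega> :: nat \<Rightarrow> real) h)\<^sup>2) \<longleftrightarrow> (\<Sum>h. ennreal ((\<omega> h)\<^sup>2)) \<noteq> \<infinity>"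
proof
  assume "summable (\<lambda>h. (\<omega> h)\<^sup>2)"
  then show "(\<Sum>h. ennreal ((\<omega> h)\<^sup>2)) \<noteq> \<infinity>"
    unfolding infinity_ennreal_def by (rule ennreal_suminf_neq_top) (rule zero_le_power2)
next
  assume "(\<Sum>h. ennreal ((\<omega> h)\<^sup>2)) \<noteq> \<infinity>"
  then show "summable (\<lambda>h. (\<omega> h)\<^sup>2)"
    unfolding infinity_ennreal_def by (rule summable_suminf_not_top[rotated]) (rule zero_le_power2)
qed

lemma measurable_synth [measurable]: "synth \<in> borel_measurable (PiM UNIV (\<lambda>_. borel))"
  unfolding synth_def[abs_def] summable_iff_suminf_ennreal by measurable

lemma measurable_synth_nu_seq: "synth \<in> borel_measurable \<nu>seq"
  by measurable

sublocale prob_space \<nu>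
  unfolding nu_eq by (rule seq.prob_space_distr) measurable

lemma suminf_variances: "(\<Sum>h. ennreal (b_const m * \<mu> h powr (1 / m))) \<noteq> \<infinity>"
  using ennreal_suminf_neq_top[OF summable_mult[OF summable_\<mu>]] b_const_pos[OF m_pos] by simp

lemma nn_integral_suminf_square:
  "(\<integral>\<^sup>+\<omega>. (\<Sum>h. ennreal ((\<omega> h)\<^sup>2)) \<partial>\<nu>seq) = (\<Sum>h. ennreal (b_const m * \<mu> h powr (1 / m)))"
proof -
  have "(\<integral>\<^sup>+\<omega>. ennreal ((\<omega> h)\<^sup>2) \<partial>\<nu>seq) = ennreal (b_const m * \<mu> h powr (1 / m))" for h
  proof -
    have "(\<integral>\<^sup>+t. ennreal (t\<^sup>2) \<partial>distr \<nu>seq borel (\<lambda>\<omega>. \<omega> h)) = (\<integral>\<^sup>+\<omega>. ennreal ((\<omega> h)\<^sup>2) \<partial>\<nu>seq)"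
      by (rule nn_integral_distr[OF measurable_coord_nu_seq]) simp
    then show ?thesis
      by (simp only: distr_nu_seq_coord nn_integral_nu1_square[OF m_pos \<mu>])
  qed
  then show ?thesis
    by (subst nn_integral_suminf) auto
qed

text \<open>The sum of the squared coordinates has as its expectation the sum of the variances, which is
  finite; hence the default value in the definition of \<^const>\<open>nu\<close> is taken on a null set only.\<close>

lemma AE_square_summable: "AE \<omega> in \<nu>seq. summable (\<lambda>h. (\<omega> h)\<^sup>2)"
  unfolding summable_iff_suminf_ennreal
  by (rule nn_integral_PInf_AE) (measurable, simp only: nn_integral_suminf_square, rule suminf_variances)

lemma synth_inner: "summable (\<lambda>h. (\<omega> h)\<^sup>2) \<Longrightarrow> synth \<omega> \<bullet> e h = \<omega> h"
  by (simp add: synth_def orthonormal_series_inner[OF e])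

lemma measurable_inner_coords [measurable]: "(\<lambda>x h. x \<bullet> e h) \<in> measurable borel (PiM UNIV (\<lambda>_. borel))"
  by (rule measurable_PiM_single') auto

text \<open>Almost surely \<open>synth\<close> inverts the passage to coordinates, so the coordinates of a point
  chosen according to \<open>\<nu>\<close> are independent with the prescribed one-dimensional laws.\<close>

lemma distr_coords: "distr \<nu> (PiM UNIV (\<lambda>_. borel)) (\<lambda>x h. x \<bullet> e h) = \<nu>seq"
proof -
  have "distr \<nu> (PiM UNIV (\<lambda>_. borel)) (\<lambda>x h. x \<bullet> e h) =
      distr \<nu>seq (PiM UNIV (\<lambda>_. borel)) ((\<lambda>x h. x \<bullet> e h) \<circ> synth)"
    unfolding nu_eq by (rule distr_distr) measurable
  also have "\<dots> = distr \<nu>seq \<nu>seq (\<lambda>\<omega>. \<omega>)"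
    using AE_square_summable
    by (intro distr_cong_AE) (auto simp: sets_nu_seq synth_inner o_def elim!: eventually_mono)
  finally show ?thesis by simp
qed

lemma distr_coord: "distr \<nu> borel (\<lambda>x. x \<bullet> e h) = nu1 m (\<mu> h)"
proof -
  have "distr \<nu> borel (\<lambda>x. x \<bullet> e h) = distr (distr \<nu> (PiM UNIV (\<lambda>_. borel)) (\<lambda>x h. x \<bullet> e h)) borel (\<lambda>\<omega>. \<omega> h)"
    by (subst distr_distr) (auto simp: o_def)
  then show ?thesis by (simp only: distr_coords distr_nu_seq_coord)
qed

lemma nn_integral_coord:
  "f \<in> borel_measurable borel \<Longrightarrow> (\<integral>\<^sup>+x. f (x \<bullet> e h) \<partial>\<nu>) = (\<integral>\<^sup>+t. f t \<partial>nu1 m (\<mu> h))"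
  unfolding distr_coord[symmetric] by (subst nn_integral_distr) auto

lemma integral_coord:
  fixes f :: "real \<Rightarrow> real"
  shows "f \<in> borel_measurable borel \<Longrightarrow> (\<integral>x. f (x \<bullet> e h) \<partial>\<nu>) = (\<integral>t. f t \<partial>nu1 m (\<mu> h))"
  unfolding distr_coord[symmetric] by (subst integral_distr) auto

lemma integrable_coord:
  fixes f :: "real \<Rightarrow> real"
  shows "f \<in> borel_measurable borel \<Longrightarrow> integrable \<nu> (\<lambda>x. f (x \<bullet> e h)) \<longleftrightarrow> integrable (nu1 m (\<mu> h)) f"
  unfolding distr_coord[symmetric] by (subst integrable_distr_eq) auto

lemma indep_coords: "indep_vars (\<lambda>_. borel) (\<lambda>h x. x \<bullet> e h) UNIV"
proof (subst indep_vars_iff_distr_eq_PiM')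
  have "(\<Pi>\<^sub>M h\<in>UNIV. distr \<nu> borel (\<lambda>x. x \<bullet> e h)) = \<nu>seq"
    by (simp add: distr_coord nu_seq_def)
  then show "distr \<nu> (PiM UNIV (\<lambda>_. borel)) (\<lambda>x. \<lambda>h\<in>UNIV. x \<bullet> e h) =
      (\<Pi>\<^sub>M h\<in>UNIV. distr \<nu> borel (\<lambda>x. x \<bullet> e h))"
    by (simp add: distr_coords restrict_def)
qed auto

section \<open>The covariance operator and its square root\<close>

lemma nn_integral_norm_square: "(\<integral>\<^sup>+x. ennreal ((norm x)\<^sup>2) \<partial>\<nu>) \<noteq> \<infinity>"
proof -
  have "ennreal ((norm x)\<^sup>2) = (\<Sum>h. ennreal ((x \<bullet> e h)\<^sup>2))" for x :: 'a
    using parseval_sums[OF e, of x x]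
    by (subst suminf_ennreal2) (auto simp: sums_iff power2_norm_eq_inner power2_eq_square[of "_ \<bullet> _"])
  then have "(\<integral>\<^sup>+x. ennreal ((norm x)\<^sup>2) \<partial>\<nu>) = (\<integral>\<^sup>+x. (\<Sum>h. ennreal ((x \<bullet> e h)\<^sup>2)) \<partial>\<nu>)"
    by simp
  also have "\<dots> = (\<integral>\<^sup>+\<omega>. (\<Sum>h. ennreal ((\<omega> h)\<^sup>2)) \<partial>\<nu>seq)"
    unfolding distr_coords[symmetric] by (subst nn_integral_distr) auto
  also have "\<dots> \<noteq> \<infinity>"
    unfolding nn_integral_suminf_square by (rule suminf_variances)
  finally show ?thesis .
qed

lemma integrable_norm_square: "integrable \<nu> (\<lambda>x. (norm x)\<^sup>2)"
  using nn_integral_norm_square by (intro integrableI_nonneg) (auto simp: less_top)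

lemma integrable_id: "integrable \<nu> (\<lambda>x. x)"
proof (rule Bochner_Integration.integrable_bound)
  show "integrable \<nu> (\<lambda>x. 1 + (norm x)\<^sup>2)"
    using integrable_norm_square by simp
  show "AE x in \<nu>. norm x \<le> norm (1 + (norm x)\<^sup>2)"
  proof (rule AE_I2)
    fix x :: 'a
    have "0 \<le> (norm x - 1)\<^sup>2" by simp
    then have "2 * norm x \<le> 1 + (norm x)\<^sup>2" by (simp add: power2_diff)
    then show "norm x \<le> norm (1 + (norm x)\<^sup>2)"
      using norm_ge_zero[of x] unfolding real_norm_def by linarith
  qed
qed simp

lemma mean_zero: "(\<integral>x. x \<partial>\<nu>) = 0"
proof (rule basis_inner_eqI[OF e])
  fix h
  have "(\<integral>x. x \<partial>\<nu>) \<bullet> e h = (\<integral>x. x \<bullet> e h \<partial>\<nu>)"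
    using integral_inner_left[OF integrable_id, of "e h"] by simp
  also have "\<dots> = 0" by (simp add: integral_coord[of "\<lambda>t. t"] integral_nu1_id m_pos)
  finally show "(\<integral>x. x \<partial>\<nu>) \<bullet> e h = 0 \<bullet> e h" by simp
qed

lemma integrable_inner_mult: "integrable \<nu> (\<lambda>u. (u \<bullet> x) * (u \<bullet> y))"
proof (rule Bochner_Integration.integrable_bound)
  show "integrable \<nu> (\<lambda>u. norm x * norm y * (norm u)\<^sup>2)"
    using integrable_norm_square by simp
  show "AE u in \<nu>. norm ((u \<bullet> x) * (u \<bullet> y)) \<le> norm (norm x * norm y * (norm u)\<^sup>2)"
  proof (rule AE_I2)
    fix u :: 'a
    have "\<bar>u \<bullet> x\<bar> * \<bar>u \<bullet> y\<bar> \<le> (norm u * norm x) * (norm u * norm y)"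
      by (intro mult_mono Cauchy_Schwarz_ineq2) auto
    then show "norm ((u \<bullet> x) * (u \<bullet> y)) \<le> norm (norm x * norm y * (norm u)\<^sup>2)"
      by (simp add: abs_mult power2_eq_square mult_ac)
  qed
qed simp

lemma covariance_basis:
  "(\<integral>u. (u \<bullet> e h) * (u \<bullet> e k) \<partial>\<nu>) = (if h = k then b_const m * \<mu> h powr (1 / m) else 0)"
proof (cases "h = k")
  case True
  then show ?thesis
    using integral_coord[of "\<lambda>t. t\<^sup>2" k] integral_nu1_square[OF m_pos \<mu>[of k]]
    by (simp add: power2_eq_square)
next
  case False
  have int: "integrable \<nu> (\<lambda>x. x \<bullet> e i)" for i
    using integrable_inner_left[OF integrable_id, of "e i"] by simp
  have "(\<integral>u. (\<Prod>i\<in>{h,k}. u \<bullet> e i) \<partial>\<nu>) = (\<Prod>i\<in>{h,k}. \<integral>u. u \<bullet> e i \<partial>\<nu>)"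
    by (intro indep_vars_lebesgue_integral indep_vars_subset[OF indep_coords] int) auto
  then show ?thesis
    using False by (simp add: integral_coord[of "\<lambda>t. t"] integral_nu1_id m_pos)
qed

lemma bounded_linear_second_moment: "bounded_linear (\<lambda>y. \<integral>u. (u \<bullet> x) * (u \<bullet> y) \<partial>\<nu>)"
proof (rule bounded_linear_intro)
  show "(\<integral>u. (u \<bullet> x) * (u \<bullet> (y + y')) \<partial>\<nu>) = (\<integral>u. (u \<bullet> x) * (u \<bullet> y) \<partial>\<nu>) + (\<integral>u. (u \<bullet> x) * (u \<bullet> y') \<partial>\<nu>)" for y y'
    by (simp add: inner_add_right distrib_left integrable_inner_mult)
  show "(\<integral>u. (u \<bullet> x) * (u \<bullet> (r *\<^sub>R y)) \<partial>\<nu>) = r *\<^sub>R (\<integral>u. (u \<bullet> x) * (u \<bullet> y) \<partial>\<nu>)" for r y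
    by (simp add: mult.left_commute)
  show "norm (\<integral>u. (u \<bullet> x) * (u \<bullet> y) \<partial>\<nu>) \<le> norm y * (norm x * (\<integral>u. (norm u)\<^sup>2 \<partial>\<nu>))" for y
  proof -
    have "norm (\<integral>u. (u \<bullet> x) * (u \<bullet> y) \<partial>\<nu>) \<le> (\<integral>u. norm ((u \<bullet> x) * (u \<bullet> y)) \<partial>\<nu>)"
      by (rule integral_norm_bound)
    also have "\<dots> \<le> (\<integral>u. norm y * norm x * (norm u)\<^sup>2 \<partial>\<nu>)"
    proof (rule integral_mono)
      fix u :: 'a
      have "\<bar>u \<bullet> x\<bar> * \<bar>u \<bullet> y\<bar> \<le> (norm u * norm x) * (norm u * norm y)"
        by (intro mult_mono Cauchy_Schwarz_ineq2) auto
      then show "norm ((u \<bullet> x) * (u \<bullet> y)) \<le> norm y * norm x * (norm u)\<^sup>2"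
        by (simp add: abs_mult power2_eq_square mult_ac)
    qed (use integrable_norm_square in \<open>auto intro!: integrable_norm integrable_inner_mult\<close>)
    finally show ?thesis by (simp add: mult.assoc)
  qed
qed

text \<open>The eigenvalues of the square root of the covariance.\<close>

definition qhalf :: "nat \<Rightarrow> real" where
  "qhalf h = sqrt (b_const m) * \<mu> h powr (1 / (2 * m))"

lemma qhalf_pos: "qhalf h > 0"
  using \<mu>[of h] by (simp add: qhalf_def b_const_pos m_pos)

lemma qhalf_square: "(qhalf h)\<^sup>2 = b_const m * \<mu> h powr (1 / m)"
  using \<mu>[of h] b_const_pos[OF m_pos] by (simp add: qhalf_def power_mult_distrib powr_power)

lemma bounded_variances: "bounded (range (\<lambda>h. (qhalf h)\<^sup>2))"
  unfolding qhalf_square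
  by (intro convergent_imp_bounded[OF summable_LIMSEQ_zero] summable_mult summable_\<mu>)

lemma bounded_qhalf: "bounded (range qhalf)"
proof -
  obtain B where B: "\<And>h. (qhalf h)\<^sup>2 \<le> B"
    using bounded_variances by (auto simp: bounded_iff)
  have "\<bar>qhalf h\<bar> \<le> sqrt B" for h
    using real_sqrt_le_mono[OF B[of h]] by simp
  then show ?thesis by (auto simp: bounded_iff)
qed

text \<open>Both sides are continuous bilinear forms, so it suffices to compare them on pairs of basis
  vectors, where independence gives the values.\<close>

lemma second_moment_eq:
  "(\<integral>u. (u \<bullet> x) * (u \<bullet> y) \<partial>\<nu>) = diag_op e (\<lambda>h. (qhalf h)\<^sup>2) x \<bullet> y"
proof -
  let ?D = "diag_op e (\<lambda>h. (qhalf h)\<^sup>2)"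
  note BV = bounded_variances
  have basis: "(\<integral>u. (u \<bullet> e h) * (u \<bullet> y) \<partial>\<nu>) = ?D (e h) \<bullet> y" for h y
  proof -
    have "(\<lambda>y. \<integral>u. (u \<bullet> e h) * (u \<bullet> y) \<partial>\<nu>) = (\<lambda>y. ?D (e h) \<bullet> y)"
      by (intro bounded_linear_eqI_on_basis[OF e] bounded_linear_second_moment bounded_linear_inner_right)
        (simp add: covariance_basis diag_op_basis[OF e BV] orthonormal_inner[OF e] flip: qhalf_square)
    then show ?thesis by (rule fun_cong)
  qed
  have "(\<lambda>x. \<integral>u. (u \<bullet> y) * (u \<bullet> x) \<partial>\<nu>) = (\<lambda>x. ?D x \<bullet> y)"
    using basis[of _ y]
    by (intro bounded_linear_eqI_on_basis[OF e] bounded_linear_second_moment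
        bounded_linear_compose[OF bounded_linear_inner_left bounded_linear_diag_op[OF e BV]])
      (simp add: mult.commute)
  from fun_cong[OF this, of x] show ?thesis by (simp add: mult.commute)
qed

lemma covariance_op_eq: "covariance_op \<nu> = diag_op e (\<lambda>h. (qhalf h)\<^sup>2)"
  unfolding covariance_op_def mean_zero
proof (rule the_equality, intro conjI allI)
  show "bounded_linear (diag_op e (\<lambda>h. (qhalf h)\<^sup>2))"
    by (rule bounded_linear_diag_op[OF e bounded_variances])
next
  show "diag_op e (\<lambda>h. (qhalf h)\<^sup>2) x \<bullet> y = (\<integral>u. (u - 0) \<bullet> x * ((u - 0) \<bullet> y) \<partial>\<nu>)" for x y
    by (simp add: second_moment_eq)
next
  fix Q :: "'a \<Rightarrow> 'a"
  assume Q: "bounded_linear Q \<and> (\<forall>x y. Q x \<bullet> y = (\<integral>u. (u - 0) \<bullet> x * ((u - 0) \<bullet> y) \<partial>\<nu>))"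
  show "Q = diag_op e (\<lambda>h. (qhalf h)\<^sup>2)"
  proof
    show "Q x = diag_op e (\<lambda>h. (qhalf h)\<^sup>2) x" for x
      by (rule basis_inner_eqI[OF e]) (use Q in \<open>simp add: second_moment_eq\<close>)
  qed
qed

lemma op_sqrt_covariance_op: "op_sqrt (covariance_op \<nu>) = diag_op e qhalf"
  unfolding covariance_op_eq by (rule op_sqrt_diag_op[OF e bounded_qhalf qhalf_pos])

end

section \<open>Square-summable combinations of the scores\<close>

text \<open>Since \<open>ln (u / p) \<le> u / p - 1\<close>, the maximum of \<open>p * ln u - u\<close> is at most \<open>p * ln p - p\<close>;
  the harmless factor \<open>exp (- p)\<close> is dropped.\<close>

lemma powr_le_exp:
  fixes u p :: real
  assumes u: "u \<ge> 0" and p: "p > 0"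
  shows "u powr p \<le> exp (p * ln p) * exp u"
proof (cases "u = 0")
  case False
  then have "ln (u / p) \<le> u / p - 1" using u p by (intro ln_le_minus_one) simp
  then have "p * ln u \<le> p * ln p + u" using u p False by (simp add: ln_div field_simps)
  then show ?thesis
    using False by (simp add: powr_def exp_add[symmetric])
qed (simp add: p)

context hilbert_product_measure
begin

definition Y :: "nat \<Rightarrow> 'a \<Rightarrow> real" where
  "Y h x = score m (\<mu> h) (x \<bullet> e h)"

lemma measurable_Y [measurable]: "Y h \<in> borel_measurable borel"
  unfolding Y_def[abs_def] by measurable

lemma W_term_eq: "W_term m \<mu> e z h x = sqrt (b_const m) * (z \<bullet> e h) * Y h x"
  by (simp add: W_term_def Y_def score_def)

text \<open>By independence the moment generating functions multiply, so the exponents add up to the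
  sum of the squares of the coefficients.\<close>

lemma mgf_sum_bound:
  obtains C :: real where "C \<ge> 0"
    "\<And>A c. finite A \<Longrightarrow> (\<And>h. h \<in> A \<Longrightarrow> \<bar>c h\<bar> \<le> 1) \<Longrightarrow>
      (\<integral>\<^sup>+x. ennreal (exp (\<Sum>h\<in>A. c h * Y h x)) \<partial>\<nu>) \<le> ennreal (exp (C * (\<Sum>h\<in>A. (c h)\<^sup>2)))"
proof -
  obtain C where C: "C \<ge> 0" and mgf: "\<And>\<mu> l. \<mu> > 0 \<Longrightarrow> \<bar>l\<bar> \<le> 1 \<Longrightarrow>
      (\<integral>\<^sup>+t. ennreal (exp (l * score m \<mu> t)) \<partial>nu1 m \<mu>) \<le> ennreal (exp (C * l\<^sup>2))"
    by (rule score_mgf_bound[OF m]) blast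
  have "(\<integral>\<^sup>+x. ennreal (exp (\<Sum>h\<in>A. c h * Y h x)) \<partial>\<nu>) \<le> ennreal (exp (C * (\<Sum>h\<in>A. (c h)\<^sup>2)))"
    if A: "finite A" and c: "\<And>h. h \<in> A \<Longrightarrow> \<bar>c h\<bar> \<le> 1" for A and c :: "nat \<Rightarrow> real"
  proof -
    have "(\<integral>\<^sup>+x. ennreal (exp (\<Sum>h\<in>A. c h * Y h x)) \<partial>\<nu>) = (\<integral>\<^sup>+x. (\<Prod>h\<in>A. ennreal (exp (c h * Y h x))) \<partial>\<nu>)"
      by (simp add: exp_sum A prod_ennreal)
    also have "\<dots> = (\<Prod>h\<in>A. \<integral>\<^sup>+x. ennreal (exp (c h * Y h x)) \<partial>\<nu>)"
    proof (rule indep_vars_nn_integral[OF A])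
      show "indep_vars (\<lambda>_. borel) (\<lambda>h x. ennreal (exp (c h * Y h x))) A"
        unfolding Y_def
        by (rule indep_vars_compose2[OF indep_vars_subset[OF indep_coords],
            of A "\<lambda>h t. ennreal (exp (c h * score m (\<mu> h) t))"]) auto
    qed simp
    also have "\<dots> \<le> (\<Prod>h\<in>A. ennreal (exp (C * (c h)\<^sup>2)))"
    proof (rule prod_mono_ennreal)
      fix h assume "h \<in> A"
      then show "(\<integral>\<^sup>+x. ennreal (exp (c h * Y h x)) \<partial>\<nu>) \<le> ennreal (exp (C * (c h)\<^sup>2))"
        unfolding Y_def
        using nn_integral_coord[of "\<lambda>t. ennreal (exp (c h * score m (\<mu> h) t))" h] mgf[OF \<mu> c] by simp
    qed
    also have "\<dots> = ennreal (exp (C * (\<Sum>h\<in>A. (c h)\<^sup>2)))"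
      by (simp add: prod_ennreal exp_sum A sum_distrib_left)
    finally show ?thesis .
  qed
  with C show thesis by (rule that)
qed

text \<open>All moments of such a combination are controlled by its variance: after division by
  \<open>t = sqrt (\<Sum>h\<in>A. (c h)\<^sup>2)\<close> the preceding bound applies with coefficients of modulus at most \<open>1\<close>
  and gives a constant.\<close>

lemma moment_bound:
  assumes p: "p > 0"
  obtains K :: real where "K \<ge> 0"
    "\<And>A c. finite A \<Longrightarrow>
      (\<integral>\<^sup>+x. ennreal (\<bar>\<Sum>h\<in>A. c h * Y h x\<bar> powr p) \<partial>\<nu>) \<le> ennreal (K * (\<Sum>h\<in>A. (c h)\<^sup>2) powr (p / 2))"
proof -
  obtain C where C: "C \<ge> 0" and mgf: "\<And>A c. finite A \<Longrightarrow> (\<And>h. h \<in> A \<Longrightarrow> \<bar>c h\<bar> \<le> 1) \<Longrightarrow>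
      (\<integral>\<^sup>+x. ennreal (exp (\<Sum>h\<in>A. c h * Y h x)) \<partial>\<nu>) \<le> ennreal (exp (C * (\<Sum>h\<in>A. (c h)\<^sup>2)))"
    by (rule mgf_sum_bound) blast
  define D where "D = exp (p * ln p)"
  define K where "K = D * (2 * exp C)"
  have K0: "K \<ge> 0" by (simp add: K_def D_def)
  have "(\<integral>\<^sup>+x. ennreal (\<bar>\<Sum>h\<in>A. c h * Y h x\<bar> powr p) \<partial>\<nu>) \<le> ennreal (K * (\<Sum>h\<in>A. (c h)\<^sup>2) powr (p / 2))"
    if A: "finite A" for A and c :: "nat \<Rightarrow> real"
  proof (cases "(\<Sum>h\<in>A. (c h)\<^sup>2) = 0")
    case True
    then have "\<And>h. h \<in> A \<Longrightarrow> c h = 0" using A by (simp add: sum_nonneg_eq_0_iff)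
    then have "(\<Sum>h\<in>A. c h * Y h x) = 0" for x by simp
    then show ?thesis by simp
  next
    case False
    define t where "t = sqrt (\<Sum>h\<in>A. (c h)\<^sup>2)"
    have sum0: "(\<Sum>h\<in>A. (c h)\<^sup>2) > 0" using False by (simp add: less_le sum_nonneg)
    then have t: "t > 0" "t\<^sup>2 = (\<Sum>h\<in>A. (c h)\<^sup>2)" by (auto simp: t_def)
    have tp: "t powr p = (\<Sum>h\<in>A. (c h)\<^sup>2) powr (p / 2)"
      using sum0 by (simp add: t_def powr_half_sqrt[symmetric] powr_powr)
    have le1: "\<bar>c h / t\<bar> \<le> 1" if "h \<in> A" for h
    proof -
      have "(c h)\<^sup>2 \<le> t\<^sup>2" unfolding t using A that by (intro member_le_sum) auto
      then show ?thesis using t(1) by (simp add: abs_le_square_iff[symmetric])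
    qed
    have sq1: "(\<Sum>h\<in>A. (c h / t)\<^sup>2) = 1"
      using False by (simp add: power_divide sum_divide_distrib[symmetric] t(2))
    let ?S = "\<lambda>x. \<Sum>h\<in>A. (c h / t) * Y h x"
    have S: "(\<Sum>h\<in>A. c h * Y h x) = t * ?S x" for x
      using t(1) by (simp add: sum_distrib_left)
    have m1: "(\<integral>\<^sup>+x. ennreal (exp (?S x)) \<partial>\<nu>) \<le> ennreal (exp C)"
      using mgf[OF A, of "\<lambda>h. c h / t"] le1 sq1 by simp
    have m2: "(\<integral>\<^sup>+x. ennreal (exp (- ?S x)) \<partial>\<nu>) \<le> ennreal (exp C)"
      using mgf[OF A, of "\<lambda>h. - (c h / t)"] le1 sq1 by (simp add: sum_negf)
    have "(\<integral>\<^sup>+x. ennreal (\<bar>\<Sum>h\<in>A. c h * Y h x\<bar> powr p) \<partial>\<nu>) \<le>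
        (\<integral>\<^sup>+x. ennreal (t powr p * D) * (ennreal (exp (?S x)) + ennreal (exp (- ?S x))) \<partial>\<nu>)"
    proof (rule nn_integral_mono)
      fix x
      have "\<bar>?S x\<bar> powr p \<le> D * exp \<bar>?S x\<bar>"
        unfolding D_def by (rule powr_le_exp) (auto simp: p)
      also have "exp \<bar>?S x\<bar> \<le> exp (?S x) + exp (- ?S x)"
        by (cases "?S x \<ge> 0") auto
      finally have "\<bar>?S x\<bar> powr p \<le> D * (exp (?S x) + exp (- ?S x))"
        by (simp add: D_def)
      then have "t powr p * \<bar>?S x\<bar> powr p \<le> t powr p * (D * (exp (?S x) + exp (- ?S x)))"
        by (intro mult_left_mono) auto
      moreover have "\<bar>\<Sum>h\<in>A. c h * Y h x\<bar> powr p = t powr p * \<bar>?S x\<bar> powr p"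
        unfolding S using t(1) by (simp add: abs_mult powr_mult)
      ultimately show "ennreal (\<bar>\<Sum>h\<in>A. c h * Y h x\<bar> powr p) \<le>
          ennreal (t powr p * D) * (ennreal (exp (?S x)) + ennreal (exp (- ?S x)))"
        by (simp add: D_def ennreal_plus[symmetric] ennreal_mult''[symmetric] mult.assoc del: ennreal_plus)
    qed
    also have "\<dots> = ennreal (t powr p * D) *
        ((\<integral>\<^sup>+x. ennreal (exp (?S x)) \<partial>\<nu>) + (\<integral>\<^sup>+x. ennreal (exp (- ?S x)) \<partial>\<nu>))"
      by (subst nn_integral_cmult, simp, subst nn_integral_add) auto
    also have "\<dots> \<le> ennreal (t powr p * D) * (ennreal (exp C) + ennreal (exp C))"
      by (intro mult_left_mono add_mono m1 m2) auto
    also have "\<dots> = ennreal (K * (\<Sum>h\<in>A. (c h)\<^sup>2) powr (p / 2))"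
      by (simp add: K_def D_def tp ennreal_plus[symmetric] ennreal_mult''[symmetric] mult_ac del: ennreal_plus)
    finally show ?thesis .
  qed
  with K0 show thesis by (rule that)
qed

lemma integrable_abs_powr_sum:
  assumes "p > 0" "finite A"
  shows "integrable \<nu> (\<lambda>x. \<bar>\<Sum>h\<in>A. c h * Y h x\<bar> powr p)"
proof (rule integrableI_nonneg)
  obtain K where K: "\<And>A c. finite A \<Longrightarrow>
      (\<integral>\<^sup>+x. ennreal (\<bar>\<Sum>h\<in>A. c h * Y h x\<bar> powr p) \<partial>\<nu>) \<le> ennreal (K * (\<Sum>h\<in>A. (c h)\<^sup>2) powr (p / 2))"
    by (rule moment_bound[OF assms(1)]) blast
  show "(\<integral>\<^sup>+x. ennreal (\<bar>\<Sum>h\<in>A. c h * Y h x\<bar> powr p) \<partial>\<nu>) < \<infinity>"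
    using K[OF assms(2), of c] by (rule le_less_trans) simp
qed auto

text \<open>The moment bound makes the partial sums Cauchy in every \<open>L\<^sup>p\<close>; the almost sure limit along one subsequence
  is, by Fatou's lemma, their limit in every \<open>L\<^sup>p\<close>.\<close>

lemma ex_Lp_limit:
  assumes c: "summable (\<lambda>h. (c h)\<^sup>2)"
  shows "\<exists>W. \<forall>p>0. Lp_sums \<nu> p (\<lambda>h x. c h * Y h x) W"
proof -
  define S where "S n x = (\<Sum>h<n. c h * Y h x)" for n x
  define tail where "tail n = (\<Sum>h. (c (h + n))\<^sup>2)" for n
  have [measurable]: "S n \<in> borel_measurable borel" for n
    unfolding S_def[abs_def] by measurable
  have tail_lim: "tail \<longlonglongrightarrow> 0"
    unfolding tail_def using suminf_exist_split2[OF c] by simp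
  have tail_ge: "(\<Sum>h=n..<k. (c h)\<^sup>2) \<le> tail n" if "n \<le> k" for n k
  proof -
    have "(\<Sum>h=n..<k. (c h)\<^sup>2) = (\<Sum>h<k-n. (c (h + n))\<^sup>2)"
      using that by (simp add: sum.atLeastLessThan_shift_0[of _ n k] lessThan_atLeast0 add.commute)
    also have "\<dots> \<le> tail n"
      unfolding tail_def by (intro sum_le_suminf) (auto intro: summable_ignore_initial_segment[OF c])
    finally show ?thesis .
  qed
  have tail0: "tail n \<ge> 0" for n
    unfolding tail_def by (intro suminf_nonneg) (auto intro: summable_ignore_initial_segment[OF c])
  have diff: "S k x - S n x = (\<Sum>h=n..<k. c h * Y h x)" if "n \<le> k" for n k x
    using that by (simp add: S_def lessThan_atLeast0 sum_diff_nat_ivl)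
  have increment: "\<exists>K\<ge>0. \<forall>n k. n \<le> k \<longrightarrow>
      (\<integral>\<^sup>+x. ennreal (\<bar>S n x - S k x\<bar> powr p) \<partial>\<nu>) \<le> ennreal (K * tail n powr (p / 2))" if p: "p > 0" for p
  proof -
    obtain K where K: "K \<ge> 0" "\<And>A c. finite A \<Longrightarrow>
      (\<integral>\<^sup>+x. ennreal (\<bar>\<Sum>h\<in>A. c h * Y h x\<bar> powr p) \<partial>\<nu>) \<le> ennreal (K * (\<Sum>h\<in>A. (c h)\<^sup>2) powr (p / 2))"
      by (rule moment_bound[OF p]) blast
    show ?thesis
    proof (intro exI[of _ K] conjI K(1) allI impI)
      fix n k :: nat assume nk: "n \<le> k"
      have "(\<integral>\<^sup>+x. ennreal (\<bar>S n x - S k x\<bar> powr p) \<partial>\<nu>) \<le> ennreal (K * (\<Sum>h=n..<k. (c h)\<^sup>2) powr (p / 2))"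
        using K(2)[of "{n..<k}" c] by (simp add: diff[OF nk, symmetric] abs_minus_commute)
      also have "\<dots> \<le> ennreal (K * tail n powr (p / 2))"
        using tail_ge[OF nk] p K(1) by (intro ennreal_leI mult_left_mono powr_mono2) (auto intro: sum_nonneg)
      finally show "(\<integral>\<^sup>+x. ennreal (\<bar>S n x - S k x\<bar> powr p) \<partial>\<nu>) \<le> ennreal (K * tail n powr (p / 2))" .
    qed
  qed
  have tail_pow: "(\<lambda>n. K * tail n powr q) \<longlonglongrightarrow> 0" if "q > 0" for K q
    using that by (intro tendsto_mult_right_zero tendsto_zero_powrI[OF tail_lim tendsto_const]) (auto simp: tail0)
  obtain r where r: "strict_mono r" "AE x in \<nu>. Cauchy (\<lambda>i. S (r i) x)"
  proof (rule cauchy_L1_AE_cauchy_subseq[where M = \<nu> and s = S])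
    show "integrable \<nu> (S n)" for n
    proof -
      have "integrable \<nu> (\<lambda>x. \<bar>S n x\<bar>)"
        unfolding S_def using integrable_abs_powr_sum[of 1 "{..<n}" c] by simp
      then show ?thesis by (subst (asm) integrable_abs_iff) auto
    qed
    fix \<epsilon> :: real assume \<epsilon>: "\<epsilon> > 0"
    obtain K where K: "K \<ge> 0" "\<And>n k. n \<le> k \<Longrightarrow>
        (\<integral>\<^sup>+x. ennreal (\<bar>S n x - S k x\<bar> powr 1) \<partial>\<nu>) \<le> ennreal (K * tail n powr (1 / 2))"
      using increment[of 1] by auto
    have "\<forall>\<^sub>F n in sequentially. K * tail n powr (1 / 2) < \<epsilon>"
      using tail_pow[of "1/2" K] \<epsilon> by (auto dest: order_tendstoD(2))
    then obtain N where N: "\<And>n. n \<ge> N \<Longrightarrow> K * tail n powr (1 / 2) < \<epsilon>"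
      by (auto simp: eventually_sequentially)
    have le: "(LINT x|\<nu>. norm (S i x - S j x)) < \<epsilon>" if "i \<ge> N" "i \<le> j" for i j
    proof -
      have "(LINT x|\<nu>. norm (S i x - S j x)) = enn2real (\<integral>\<^sup>+x. ennreal (norm (S i x - S j x)) \<partial>\<nu>)"
        by (rule integral_eq_nn_integral) auto
      also have "\<dots> \<le> K * tail i powr (1 / 2)"
        using K(2)[OF that(2)] K(1) by (intro enn2real_leI) auto
      also have "\<dots> < \<epsilon>" by (rule N[OF that(1)])
      finally show ?thesis .
    qed
    show "\<exists>N. \<forall>i\<ge>N. \<forall>j\<ge>N. (LINT x|\<nu>. norm (S i x - S j x)) < \<epsilon>"
    proof (intro exI[of _ N] allI impI)
      fix i j assume "i \<ge> N" "j \<ge> N"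
      then show "(LINT x|\<nu>. norm (S i x - S j x)) < \<epsilon>"
        using le[of i j] le[of j i] by (cases "i \<le> j") (auto simp: abs_minus_commute)
    qed
  qed auto
  define W where "W x = lim (\<lambda>i. S (r i) x)" for x
  have [measurable]: "W \<in> borel_measurable borel"
    unfolding W_def[abs_def] by measurable
  have conv: "AE x in \<nu>. (\<lambda>i. S (r i) x) \<longlonglongrightarrow> W x"
    using r(2) by eventually_elim (simp add: W_def Cauchy_convergent_iff convergent_LIMSEQ_iff)
  have "Lp_sums \<nu> p (\<lambda>h x. c h * Y h x) W" if p: "p > 0" for p
  proof -
    obtain K where K: "K \<ge> 0" "\<And>n k. n \<le> k \<Longrightarrow>
        (\<integral>\<^sup>+x. ennreal (\<bar>S n x - S k x\<bar> powr p) \<partial>\<nu>) \<le> ennreal (K * tail n powr (p / 2))"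
      using increment[OF p] by auto
    have bound: "(\<integral>\<^sup>+x. ennreal (\<bar>S n x - W x\<bar> powr p) \<partial>\<nu>) \<le> ennreal (K * tail n powr (p / 2))" for n
    proof -
      have "(\<integral>\<^sup>+x. ennreal (\<bar>S n x - W x\<bar> powr p) \<partial>\<nu>) =
          (\<integral>\<^sup>+x. liminf (\<lambda>i. ennreal (\<bar>S n x - S (r i) x\<bar> powr p)) \<partial>\<nu>)"
      proof (rule nn_integral_cong_AE)
        show "AE x in \<nu>. ennreal (\<bar>S n x - W x\<bar> powr p) = liminf (\<lambda>i. ennreal (\<bar>S n x - S (r i) x\<bar> powr p))"
          using conv
        proof eventually_elim
          fix x assume "(\<lambda>i. S (r i) x) \<longlonglongrightarrow> W x"
          then have "(\<lambda>i. ennreal (\<bar>S n x - S (r i) x\<bar> powr p)) \<longlonglongrightarrow> ennreal (\<bar>S n x - W x\<bar> powr p)"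
            using p by (intro tendsto_ennrealI tendsto_powr' tendsto_rabs tendsto_diff tendsto_const) auto
          then show "ennreal (\<bar>S n x - W x\<bar> powr p) = liminf (\<lambda>i. ennreal (\<bar>S n x - S (r i) x\<bar> powr p))"
            by (rule lim_imp_Liminf[OF sequentially_bot, symmetric])
        qed
      qed
      also have "\<dots> \<le> liminf (\<lambda>i. \<integral>\<^sup>+x. ennreal (\<bar>S n x - S (r i) x\<bar> powr p) \<partial>\<nu>)"
        by (rule nn_integral_liminf) auto
      also have "\<dots> \<le> liminf (\<lambda>i. ennreal (K * tail n powr (p / 2)))"
      proof (rule Liminf_mono)
        show "\<forall>\<^sub>F i in sequentially. (\<integral>\<^sup>+x. ennreal (\<bar>S n x - S (r i) x\<bar> powr p) \<partial>\<nu>) \<le> ennreal (K * tail n powr (p / 2))"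
          using eventually_ge_at_top[of n]
        proof eventually_elim
          fix i assume "n \<le> i"
          then have "n \<le> r i" using seq_suble[OF r(1), of i] by simp
          then show "(\<integral>\<^sup>+x. ennreal (\<bar>S n x - S (r i) x\<bar> powr p) \<partial>\<nu>) \<le> ennreal (K * tail n powr (p / 2))"
            by (rule K(2))
        qed
      qed
      finally show ?thesis by (simp add: Liminf_const)
    qed
    have "integrable \<nu> (\<lambda>x. \<bar>S 0 x - W x\<bar> powr p)"
      using le_less_trans[OF bound[of 0]] by (intro integrableI_nonneg) auto
    then have W: "W \<in> Lp \<nu> p"
      by (simp add: Lp_def S_def)
    have terms: "(\<lambda>x. c h * Y h x) \<in> Lp \<nu> p" for h
      using integrable_abs_powr_sum[OF p, of "{h}" c] by (simp add: Lp_def)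
    have "(\<lambda>n. Lp_norm \<nu> p (\<lambda>x. S n x - W x)) \<longlonglongrightarrow> 0"
    proof (rule tendsto_sandwich[OF _ _ tendsto_const])
      show "\<forall>\<^sub>F n in sequentially. 0 \<le> Lp_norm \<nu> p (\<lambda>x. S n x - W x)"
        by (simp add: Lp_norm_def)
      show "\<forall>\<^sub>F n in sequentially. Lp_norm \<nu> p (\<lambda>x. S n x - W x) \<le> (K * tail n powr (p / 2)) powr (1 / p)"
      proof (intro always_eventually allI)
        fix n
        have "(\<integral>x. \<bar>S n x - W x\<bar> powr p \<partial>\<nu>) = enn2real (\<integral>\<^sup>+x. ennreal (\<bar>S n x - W x\<bar> powr p) \<partial>\<nu>)"
          by (rule integral_eq_nn_integral) auto
        also have "\<dots> \<le> K * tail n powr (p / 2)"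
          using bound[of n] K(1) by (intro enn2real_leI) auto
        finally show "Lp_norm \<nu> p (\<lambda>x. S n x - W x) \<le> (K * tail n powr (p / 2)) powr (1 / p)"
          unfolding Lp_norm_def using p by (intro powr_mono2) auto
      qed
      show "(\<lambda>n. (K * tail n powr (p / 2)) powr (1 / p)) \<longlonglongrightarrow> 0"
        using p K(1) by (intro tendsto_zero_powrI[OF tail_pow tendsto_const]) (auto simp: tail0)
    qed
    then show ?thesis
      using W terms by (simp add: Lp_sums_def S_def)
  qed
  then show ?thesis by blast
qed

lemma ex_is_W: "\<exists>W. is_W m \<mu> e z W"
proof -
  have "summable (\<lambda>h. (sqrt (b_const m) * (z \<bullet> e h))\<^sup>2)"
    by (simp only: power_mult_distrib) (intro summable_mult bessel_inequality e)
  from ex_Lp_limit[OF this] obtain W where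
    "\<And>p. p > 0 \<Longrightarrow> Lp_sums \<nu> p (\<lambda>h x. sqrt (b_const m) * (z \<bullet> e h) * Y h x) W" by blast
  then have "is_W m \<mu> e z W"
    by (simp add: is_W_def W_term_eq[abs_def])
  then show ?thesis by blast
qed

end

section \<open>Hoelder's inequality\<close>

lemma hoelder_inequality:
  fixes f g :: "'b \<Rightarrow> real"
  assumes p: "p > 1" and q: "q > 1" and pq: "1 / p + 1 / q = 1"
    and f: "f \<in> Lp M p" and g: "g \<in> Lp M q"
  shows "integrable M (\<lambda>x. f x * g x)"
    and "\<bar>\<integral>x. f x * g x \<partial>M\<bar> \<le> Lp_norm M p f * Lp_norm M q g"
proof -
  have [measurable]: "f \<in> borel_measurable M" "g \<in> borel_measurable M"
    and fi: "integrable M (\<lambda>x. \<bar>f x\<bar> powr p)" and gi: "integrable M (\<lambda>x. \<bar>g x\<bar> powr q)"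
    using f g by (auto simp: Lp_def)
  have young: "\<bar>f x * g x\<bar> \<le> \<bar>f x\<bar> powr p / p + \<bar>g x\<bar> powr q / q" for x
    using Youngs_inequality[OF p q pq, of "\<bar>f x\<bar>" "\<bar>g x\<bar>"] by (simp add: abs_mult)
  show int: "integrable M (\<lambda>x. f x * g x)"
  proof (rule Bochner_Integration.integrable_bound)
    show "integrable M (\<lambda>x. \<bar>f x\<bar> powr p / p + \<bar>g x\<bar> powr q / q)"
      using fi gi by simp
    show "AE x in M. norm (f x * g x) \<le> norm (\<bar>f x\<bar> powr p / p + \<bar>g x\<bar> powr q / q)"
      unfolding real_norm_def by (intro AE_I2 order_trans[OF young abs_ge_self])
  qed simp
  define F where "F = (\<integral>x. \<bar>f x\<bar> powr p \<partial>M)"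
  define G where "G = (\<integral>x. \<bar>g x\<bar> powr q \<partial>M)"
  have F0: "F \<ge> 0" and G0: "G \<ge> 0" by (auto simp: F_def G_def)
  have norms: "Lp_norm M p f = F powr (1 / p)" "Lp_norm M q g = G powr (1 / q)"
    by (simp_all add: Lp_norm_def F_def G_def)
  show "\<bar>\<integral>x. f x * g x \<partial>M\<bar> \<le> Lp_norm M p f * Lp_norm M q g"
  proof (cases "F = 0 \<or> G = 0")
    case True
    have "AE x in M. f x * g x = 0"
    proof (cases "F = 0")
      case True
      then have "AE x in M. \<bar>f x\<bar> powr p = 0"
        using integral_nonneg_eq_0_iff_AE[OF fi] by (simp add: F_def)
      then show ?thesis by eventually_elim simp
    next
      case False
      then have "AE x in M. \<bar>g x\<bar> powr q = 0"
        using True integral_nonneg_eq_0_iff_AE[OF gi] by (simp add: G_def)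
      then show ?thesis by eventually_elim simp
    qed
    then have "(\<integral>x. f x * g x \<partial>M) = 0" by (rule integral_eq_zero_AE)
    then show ?thesis by (simp add: Lp_norm_def)
  next
    case False
    then have F: "F > 0" and G: "G > 0" using F0 G0 by auto
    define a where "a = F powr (1 / p)"
    define b where "b = G powr (1 / q)"
    have ab: "a > 0" "b > 0" and ap: "a powr p = F" and bq: "b powr q = G"
      using F G p q by (auto simp: a_def b_def powr_powr)
    have pt: "\<bar>f x * g x\<bar> / (a * b) \<le> \<bar>f x\<bar> powr p / (p * F) + \<bar>g x\<bar> powr q / (q * G)" for x
      using Youngs_inequality[OF p q pq, of "\<bar>f x\<bar> / a" "\<bar>g x\<bar> / b"] ab
      by (simp add: abs_mult powr_divide ap bq mult.commute)
    have "\<bar>\<integral>x. f x * g x \<partial>M\<bar> / (a * b) \<le> (\<integral>x. \<bar>f x * g x\<bar> \<partial>M) / (a * b)"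
      using ab integral_norm_bound[of M "\<lambda>x. f x * g x"] by (intro divide_right_mono) auto
    also have "\<dots> = (\<integral>x. \<bar>f x * g x\<bar> / (a * b) \<partial>M)" by simp
    also have "\<dots> \<le> (\<integral>x. \<bar>f x\<bar> powr p / (p * F) + \<bar>g x\<bar> powr q / (q * G) \<partial>M)"
      using fi gi int pt by (intro integral_mono) auto
    also have "\<dots> = F / (p * F) + G / (q * G)"
      using fi gi by (simp add: F_def G_def)
    also have "\<dots> = 1" using pq F G by simp
    finally show ?thesis
      using ab by (simp add: norms a_def[symmetric] b_def[symmetric] divide_le_eq)
  qed
qed

section \<open>Integration by parts on the Hilbert space\<close>

text \<open>Membership in \<^const>\<open>Cb1\<close> bounds the gradient defined by description; the Riesz
  representation shows that this gradient does represent the derivative at every point.\<close>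

lemma Cb1_cases:
  fixes e :: "nat \<Rightarrow> 'a::{real_inner,banach}" and \<phi> :: "'a \<Rightarrow> real"
  assumes e: "orthonormal_basis e" and \<phi>: "\<phi> \<in> Cb1"
  obtains B G where "\<And>x. \<bar>\<phi> x\<bar> \<le> B" "\<And>x. norm (grad \<phi> x) \<le> G"
    "\<And>x. (\<phi> has_derivative (\<lambda>v. grad \<phi> x \<bullet> v)) (at x)"
    "\<And>v. continuous_on UNIV (\<lambda>x. grad \<phi> x \<bullet> v)"
proof -
  obtain B where B: "\<And>x. \<bar>\<phi> x\<bar> \<le> B"
    using \<phi> by (auto simp: Cb1_def bounded_iff)
  obtain G where G: "\<And>x. norm (grad \<phi> x) \<le> G"
    using \<phi> by (auto simp: Cb1_def bounded_iff)
  obtain \<phi>' :: "'a \<Rightarrow> 'a \<Rightarrow>\<^sub>L real" where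
    d: "\<And>x. (\<phi> has_derivative blinfun_apply (\<phi>' x)) (at x)" and c: "continuous_on UNIV \<phi>'"
    using \<phi> by (auto simp: Cb1_def)
  have grad: "blinfun_apply (\<phi>' x) = (\<lambda>v. grad \<phi> x \<bullet> v)" for x
  proof -
    obtain g where g: "\<And>v. blinfun_apply (\<phi>' x) v = v \<bullet> g"
      using riesz_representation[OF e blinfun.bounded_linear_right] by metis
    have "GDERIV \<phi> x :> g"
      using d[of x] by (simp add: gderiv_def g[abs_def] inner_commute)
    then have "grad \<phi> x = g"
      unfolding grad_def
    proof (rule the_equality)
      fix g' assume "GDERIV \<phi> x :> g'"
      then have "(\<lambda>v. v \<bullet> g') = blinfun_apply (\<phi>' x)"
        using d[of x] unfolding gderiv_def by (rule has_derivative_unique)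
      then have "v \<bullet> g' = v \<bullet> g" for v by (metis g)
      then show "g' = g" by (intro basis_inner_eqI[OF e]) (metis inner_commute)
    qed
    then show ?thesis by (auto simp: g inner_commute)
  qed
  show thesis
  proof (rule that[OF B G])
    show "(\<phi> has_derivative (\<lambda>v. grad \<phi> x \<bullet> v)) (at x)" for x
      using d[of x] by (simp add: grad)
    show "continuous_on UNIV (\<lambda>x. grad \<phi> x \<bullet> v)" for v
    proof -
      have "continuous_on UNIV (\<lambda>x. blinfun_apply (\<phi>' x) v)"
        by (intro continuous_intros c)
      then show ?thesis by (simp add: grad)
    qed
  qed
qed

context hilbert_product_measure
begin

lemma integrable_bounded_mult_Y:
  assumes [measurable]: "\<phi> \<in> borel_measurable borel" and B: "\<And>x. \<bar>\<phi> x\<bar> \<le> B"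
  shows "integrable \<nu> (\<lambda>x. \<phi> x * Y h x)"
proof (rule Bochner_Integration.integrable_bound[where f = "\<lambda>x. B * Y h x"])
  show "integrable \<nu> (\<lambda>x. B * Y h x)"
    using integrable_score[OF m \<mu>[of h]] integrable_coord[of "score m (\<mu> h)" h]
    by (simp add: Y_def)
  show "AE x in \<nu>. norm (\<phi> x * Y h x) \<le> norm (B * Y h x)"
    using order_trans[OF B abs_ge_self] by (intro AE_I2) (auto simp: abs_mult intro!: mult_right_mono)
qed simp

text \<open>Fubini splits off the coordinate \<open>h\<close>: for almost every choice of the others the point moves
  along a line in direction \<open>e h\<close>, where the one-dimensional formula applies.\<close>

lemma integration_by_parts_coord:
  assumes \<phi>: "\<phi> \<in> Cb1"
  shows "\<mu> h powr (1 / (2 * m)) * (\<integral>x. grad \<phi> x \<bullet> e h \<partial>\<nu>) = (\<integral>x. \<phi> x * Y h x \<partial>\<nu>)"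
proof -
  obtain B G where B: "\<And>x. \<bar>\<phi> x\<bar> \<le> B" and G: "\<And>x. norm (grad \<phi> x) \<le> G"
    and d: "\<And>x. (\<phi> has_derivative (\<lambda>v. grad \<phi> x \<bullet> v)) (at x)"
    and c: "\<And>v. continuous_on UNIV (\<lambda>x. grad \<phi> x \<bullet> v)"
    by (rule Cb1_cases[OF e \<phi>]) blast
  let ?D = "\<lambda>x. grad \<phi> x \<bullet> e h"
  have D: "\<bar>?D x\<bar> \<le> G" for x
    using Cauchy_Schwarz_ineq2[of "grad \<phi> x" "e h"] G[of x] orthonormal_inner[OF e, of h h]
    by (simp add: norm_eq_sqrt_inner)
  have "continuous_on UNIV \<phi>"
    using d by (meson has_derivative_continuous continuous_at_imp_continuous_on)
  then have [measurable]: "\<phi> \<in> borel_measurable borel" by (rule borel_measurable_continuous_onI)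
  have [measurable]: "?D \<in> borel_measurable borel" by (rule borel_measurable_continuous_onI[OF c])
  let ?N = "nu1 m (\<mu> h)"
  define R where "R = (\<Pi>\<^sub>M k\<in>UNIV - {h}. nu1 m (\<mu> k))"
  interpret N: prob_space ?N by (rule prob_space_nu1_coord)
  interpret R: prob_space R unfolding R_def by (intro prob_space_PiM prob_space_nu1_coord)
  interpret P: pair_prob_space ?N R ..
  have ins: "insert h (UNIV - {h}) = UNIV" by auto
  have upd [measurable]: "(\<lambda>(t, u). u(h := t)) \<in> measurable (?N \<Otimes>\<^sub>M R) \<nu>seq"
    unfolding case_prod_beta' nu_seq_def R_def
    by (rule measurable_fun_upd[where J = "UNIV - {h}"]) auto
  have split: "\<nu>seq = distr (?N \<Otimes>\<^sub>M R) \<nu>seq (\<lambda>(t, u). u(h := t))"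
    using distr_pair_PiM_eq_PiM[of "UNIV - {h}" "\<lambda>k. nu1 m (\<mu> k)" h] prob_space_nu1_coord
    unfolding ins R_def nu_seq_def by simp
  define J where "J y = synth ((snd y)(h := fst y))" for y
  have J [measurable]: "J \<in> borel_measurable (?N \<Otimes>\<^sub>M R)"
    using measurable_comp[OF upd measurable_synth_nu_seq] by (simp add: J_def[abs_def] comp_def case_prod_beta')
  have nuJ: "\<nu> = distr (?N \<Otimes>\<^sub>M R) borel J"
  proof -
    have "\<nu> = distr (distr (?N \<Otimes>\<^sub>M R) \<nu>seq (\<lambda>(t, u). u(h := t))) borel synth"
      using split nu_eq by simp
    also have "\<dots> = distr (?N \<Otimes>\<^sub>M R) borel J"
      using distr_distr[OF measurable_synth_nu_seq upd] by (simp add: J_def[abs_def] comp_def case_prod_beta')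
    finally show ?thesis .
  qed
  \<comment> \<open>Square-summability ignores the coordinate \<open>h\<close>, so it holds for almost every choice of the
    others and then for all values of that coordinate at once.\<close>
  have summable_upd: "summable (\<lambda>k. ((u(h := t)) k)\<^sup>2) \<longleftrightarrow> summable (\<lambda>k. (u k)\<^sup>2)"
    for u :: "nat \<Rightarrow> real" and t
    by (intro summable_cong eventually_mono[OF eventually_gt_at_top[of h]]) auto
  have "AE u in distr (?N \<Otimes>\<^sub>M R) \<nu>seq (\<lambda>(t, u). u(h := t)). summable (\<lambda>k. (u k)\<^sup>2)"
    unfolding split[symmetric] by (rule AE_square_summable)
  then have "AE y in ?N \<Otimes>\<^sub>M R. summable (\<lambda>k. ((case y of (t, u) \<Rightarrow> u(h := t)) k)\<^sup>2)"
    by (rule AE_distrD[OF upd])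
  then have "AE t in ?N. AE u in R. summable (\<lambda>k. ((u(h := t)) k)\<^sup>2)"
    by (drule_tac P.AE_pair) simp
  then have ae: "AE u in R. summable (\<lambda>k. (u k)\<^sup>2)"
    unfolding summable_upd by simp
  have line: "J (t, u) = synth (u(h := 0)) + t *\<^sub>R e h" if "summable (\<lambda>k. (u k)\<^sup>2)" for t u
    by (rule basis_inner_eqI[OF e])
      (simp add: J_def synth_inner summable_upd that inner_add_left orthonormal_inner[OF e] del: fun_upd_apply, simp)
  have i1: "integrable (?N \<Otimes>\<^sub>M R) (\<lambda>(t, u). ?D (J (t, u)))"
    by (rule P.integrable_const_bound[where B = G]) (auto simp: D)
  have i2: "integrable (?N \<Otimes>\<^sub>M R) (\<lambda>(t, u). \<phi> (J (t, u)) * Y h (J (t, u)))"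
  proof -
    have "integrable \<nu> (\<lambda>x. \<phi> x * Y h x)"
      by (rule integrable_bounded_mult_Y[OF _ B]) simp
    then show ?thesis
      unfolding nuJ by (subst (asm) integrable_distr_eq) (simp_all add: case_prod_beta')
  qed
  have fiber: "\<mu> h powr (1 / (2 * m)) * (\<integral>t. ?D (J (t, u)) \<partial>?N) = (\<integral>t. \<phi> (J (t, u)) * Y h (J (t, u)) \<partial>?N)"
    if s: "summable (\<lambda>k. (u k)\<^sup>2)" for u
  proof -
    let ?x = "\<lambda>t. synth (u(h := 0)) + t *\<^sub>R e h"
    have "J (t, u) \<bullet> e h = t" for t
    proof -
      have "synth (u(h := t)) \<bullet> e h = (u(h := t)) h"
        by (rule synth_inner, subst summable_upd, rule s)
      then show ?thesis by (simp add: J_def)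
    qed
    then have Y: "Y h (J (t, u)) = score m (\<mu> h) t" for t
      by (simp add: Y_def)
    have "\<mu> h powr (1 / (2 * m)) * (\<integral>t. ?D (?x t) \<partial>?N) = (\<integral>t. \<phi> (?x t) * score m (\<mu> h) t \<partial>?N)"
    proof (rule nu1_integration_by_parts[OF m \<mu>])
      show "((\<lambda>t. \<phi> (?x t)) has_real_derivative ?D (?x t)) (at t)" for t
      proof -
        have "(?x has_derivative (\<lambda>s. s *\<^sub>R e h)) (at t)"
          by (auto intro!: derivative_eq_intros)
        from has_derivative_compose[OF this d]
        show ?thesis by (simp add: has_field_derivative_def mult.commute[of _ "?D (?x t)"])
      qed
      show "continuous_on UNIV (\<lambda>t. ?D (?x t))"
        by (intro continuous_on_compose2[OF c] continuous_intros) auto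
    qed (rule B, rule D)
    then show ?thesis by (simp only: line[OF s] Y[unfolded line[OF s]])
  qed
  have "\<mu> h powr (1 / (2 * m)) * (\<integral>x. ?D x \<partial>\<nu>) =
      \<mu> h powr (1 / (2 * m)) * (\<integral>u. (\<integral>t. ?D (J (t, u)) \<partial>?N) \<partial>R)"
    unfolding nuJ by (subst integral_distr) (auto simp: P.integral_snd[OF i1] case_prod_beta')
  also have "\<dots> = (\<integral>u. \<mu> h powr (1 / (2 * m)) * (\<integral>t. ?D (J (t, u)) \<partial>?N) \<partial>R)"
    by simp
  also have "\<dots> = (\<integral>u. (\<integral>t. \<phi> (J (t, u)) * Y h (J (t, u)) \<partial>?N) \<partial>R)"
  proof (rule integral_cong_AE)
    show "AE u in R. \<mu> h powr (1 / (2 * m)) * (\<integral>t. ?D (J (t, u)) \<partial>?N) =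
        (\<integral>t. \<phi> (J (t, u)) * Y h (J (t, u)) \<partial>?N)"
      using ae by eventually_elim (rule fiber)
  qed measurable
  also have "\<dots> = (\<integral>x. \<phi> x * Y h x \<partial>\<nu>)"
    unfolding nuJ by (subst integral_distr) (auto simp: P.integral_snd[OF i2] case_prod_beta')
  finally show ?thesis .
qed

lemma bounded_in_Lp:
  assumes [measurable]: "\<phi> \<in> borel_measurable borel" and B: "\<And>x. \<bar>\<phi> x\<bar> \<le> B" and p: "p > 0"
  shows "\<phi> \<in> Lp \<nu> p"
proof -
  have "integrable \<nu> (\<lambda>x. \<bar>\<phi> x\<bar> powr p)"
    by (rule integrable_const_bound[where B = "B powr p"])
      (use B p in \<open>auto intro!: powr_mono2\<close>)
  then show ?thesis by (simp add: Lp_def)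
qed

text \<open>Summing the coordinate formulas gives the identity for the direction \<open>\<Sum>h<n. (z \<bullet> e h) *\<^sub>R e h\<close>
  in place of \<open>z\<close>. On the left one passes to the limit since the mean of the gradient is a bounded
  functional, on the right since the partial sums converge to \<open>W\<close> in \<open>L\<^sup>2\<close>. The last
  estimate is Hoelder's inequality.\<close>

lemma integration_by_parts:
  assumes \<phi>: "\<phi> \<in> Cb1" and W: "is_W m \<mu> e z W"
  shows "integrable \<nu> (\<lambda>x. diag_op e qhalf (grad \<phi> x) \<bullet> z)"
    and "integrable \<nu> (\<lambda>x. W x * \<phi> x)"
    and "(\<integral>x. diag_op e qhalf (grad \<phi> x) \<bullet> z \<partial>\<nu>) = (\<integral>x. W x * \<phi> x \<partial>\<nu>)"
    and "p > 1 \<Longrightarrow> \<bar>\<integral>x. W x * \<phi> x \<partial>\<nu>\<bar> \<le> Lp_norm \<nu> (p / (p - 1)) W * Lp_norm \<nu> p \<phi>"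
proof -
  obtain B G where B: "\<And>x. \<bar>\<phi> x\<bar> \<le> B" and G: "\<And>x. norm (grad \<phi> x) \<le> G"
    and d: "\<And>x. (\<phi> has_derivative (\<lambda>v. grad \<phi> x \<bullet> v)) (at x)"
    and c: "\<And>v. continuous_on UNIV (\<lambda>x. grad \<phi> x \<bullet> v)"
    by (rule Cb1_cases[OF e \<phi>]) blast
  have "continuous_on UNIV \<phi>"
    using d by (meson has_derivative_continuous continuous_at_imp_continuous_on)
  then have \<phi>_meas [measurable]: "\<phi> \<in> borel_measurable borel" by (rule borel_measurable_continuous_onI)
  have [measurable]: "(\<lambda>x. grad \<phi> x \<bullet> v) \<in> borel_measurable borel" for v
    by (rule borel_measurable_continuous_onI[OF c])
  note \<phi>Lp = bounded_in_Lp[OF \<phi>_meas B]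
  define w where "w = diag_op e qhalf z"
  have adj: "diag_op e qhalf x \<bullet> z = x \<bullet> w" for x
    using diag_op_inner_sums[OF e bounded_qhalf, of x z] diag_op_inner_sums[OF e bounded_qhalf, of z x]
    by (simp add: w_def inner_commute[of x] mult_ac sums_unique2)
  have bound: "\<bar>grad \<phi> x \<bullet> v\<bar> \<le> norm v * G" for x v
    using Cauchy_Schwarz_ineq2[of "grad \<phi> x" v] mult_right_mono[OF G[of x] norm_ge_zero[of v]]
    by (simp add: mult.commute)
  have gi: "integrable \<nu> (\<lambda>x. grad \<phi> x \<bullet> v)" for v
    by (rule integrable_const_bound[where B = "norm v * G"]) (auto simp: bound)
  show "integrable \<nu> (\<lambda>x. diag_op e qhalf (grad \<phi> x) \<bullet> z)"
    unfolding adj by (rule gi)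
  have WLp: "W \<in> Lp \<nu> p" if "p > 1" for p
    using W that by (simp add: is_W_def Lp_sums_def)
  show int: "integrable \<nu> (\<lambda>x. W x * \<phi> x)"
    by (rule hoelder_inequality(1)[OF _ _ _ WLp[of 2] \<phi>Lp[of 2]]) auto
  show "\<bar>\<integral>x. W x * \<phi> x \<partial>\<nu>\<bar> \<le> Lp_norm \<nu> (p / (p - 1)) W * Lp_norm \<nu> p \<phi>" if p: "p > 1" for p
    by (rule hoelder_inequality(2)[OF _ p _ WLp \<phi>Lp]) (use p in \<open>auto simp: field_simps\<close>)
  define S where "S n x = (\<Sum>h<n. W_term m \<mu> e z h x)" for n x
  have blin: "bounded_linear (\<lambda>v. \<integral>x. grad \<phi> x \<bullet> v \<partial>\<nu>)"
  proof (rule bounded_linear_intro)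
    show "norm (\<integral>x. grad \<phi> x \<bullet> v \<partial>\<nu>) \<le> norm v * G" for v
    proof -
      have "norm (\<integral>x. grad \<phi> x \<bullet> v \<partial>\<nu>) \<le> (\<integral>x. norm (grad \<phi> x \<bullet> v) \<partial>\<nu>)"
        by (rule integral_norm_bound)
      also have "\<dots> \<le> (\<integral>x. norm v * G \<partial>\<nu>)"
        using gi bound by (intro integral_mono) auto
      also have "\<dots> = norm v * G"
        using prob_space by simp
      finally show ?thesis .
    qed
  qed (simp_all add: inner_add_right gi)
  have "(\<lambda>n. \<Sum>h<n. (qhalf h * (z \<bullet> e h)) *\<^sub>R e h) \<longlonglongrightarrow> w"
    using basis_expansion[OF e, of w] by (simp add: w_def diag_op_inner_basis[OF e bounded_qhalf] sums_def)
  from bounded_linear.tendsto[OF blin this]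
  have lim1: "(\<lambda>n. \<integral>x. grad \<phi> x \<bullet> (\<Sum>h<n. (qhalf h * (z \<bullet> e h)) *\<^sub>R e h) \<partial>\<nu>) \<longlonglongrightarrow> (\<integral>x. grad \<phi> x \<bullet> w \<partial>\<nu>)" .
  have Wterm_int: "integrable \<nu> (\<lambda>x. W_term m \<mu> e z h x * \<phi> x)" for h
    using integrable_mult_right[OF integrable_bounded_mult_Y[OF \<phi>_meas B, where h = h], of "sqrt (b_const m) * (z \<bullet> e h)"]
    by (simp add: W_term_eq mult_ac)
  have partial: "(\<integral>x. grad \<phi> x \<bullet> (\<Sum>h<n. (qhalf h * (z \<bullet> e h)) *\<^sub>R e h) \<partial>\<nu>) = (\<integral>x. S n x * \<phi> x \<partial>\<nu>)" for n
  proof -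
    have "(\<integral>x. grad \<phi> x \<bullet> (\<Sum>h<n. (qhalf h * (z \<bullet> e h)) *\<^sub>R e h) \<partial>\<nu>) =
        (\<Sum>h<n. qhalf h * (z \<bullet> e h) * (\<integral>x. grad \<phi> x \<bullet> e h \<partial>\<nu>))"
      using gi by (simp add: inner_sum_right)
    also have "\<dots> = (\<Sum>h<n. \<integral>x. W_term m \<mu> e z h x * \<phi> x \<partial>\<nu>)"
    proof (rule sum.cong[OF refl])
      fix h
      have "qhalf h * (z \<bullet> e h) * (\<integral>x. grad \<phi> x \<bullet> e h \<partial>\<nu>) =
          sqrt (b_const m) * (z \<bullet> e h) * (\<mu> h powr (1 / (2 * m)) * (\<integral>x. grad \<phi> x \<bullet> e h \<partial>\<nu>))"
        by (simp add: qhalf_def mult_ac)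
      also have "\<dots> = (\<integral>x. sqrt (b_const m) * (z \<bullet> e h) * (\<phi> x * Y h x) \<partial>\<nu>)"
        unfolding integration_by_parts_coord[OF \<phi>] by simp
      finally show "qhalf h * (z \<bullet> e h) * (\<integral>x. grad \<phi> x \<bullet> e h \<partial>\<nu>) = (\<integral>x. W_term m \<mu> e z h x * \<phi> x \<partial>\<nu>)"
        by (simp add: W_term_eq mult_ac)
    qed
    also have "\<dots> = (\<integral>x. S n x * \<phi> x \<partial>\<nu>)"
      using Wterm_int by (simp add: S_def sum_distrib_right)
    finally show ?thesis .
  qed
  have lim2: "(\<lambda>n. \<integral>x. S n x * \<phi> x \<partial>\<nu>) \<longlonglongrightarrow> (\<integral>x. W x * \<phi> x \<partial>\<nu>)"
  proof (rule Lim_null[THEN iffD2], rule Lim_null_comparison)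
    have S2: "(\<lambda>x. S n x - W x) \<in> Lp \<nu> 2" for n
    proof -
      have "integrable \<nu> (\<lambda>x. \<bar>S n x\<bar> powr 2)"
        using integrable_abs_powr_sum[of 2 "{..<n}" "\<lambda>h. sqrt (b_const m) * (z \<bullet> e h)"]
        by (simp add: S_def W_term_eq)
      moreover have [measurable]: "S n \<in> borel_measurable borel" "W \<in> borel_measurable borel"
        using WLp[of 2] by (auto simp: S_def[abs_def] W_term_eq Lp_def)
      moreover have "integrable \<nu> (\<lambda>x. \<bar>W x\<bar> powr 2)"
        using WLp[of 2] by (simp add: Lp_def)
      ultimately have "integrable \<nu> (\<lambda>x. 2 * \<bar>S n x\<bar> powr 2 + 2 * \<bar>W x\<bar> powr 2)" by simp
      then have "integrable \<nu> (\<lambda>x. \<bar>S n x - W x\<bar> powr 2)"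
      proof (rule Bochner_Integration.integrable_bound)
        have "(a - b)\<^sup>2 \<le> 2 * a\<^sup>2 + 2 * b\<^sup>2" for a b :: real
          using zero_le_power2[of "a + b"] by (simp add: power2_eq_square algebra_simps)
        then show "AE x in \<nu>. norm (\<bar>S n x - W x\<bar> powr 2) \<le> norm (2 * \<bar>S n x\<bar> powr 2 + 2 * \<bar>W x\<bar> powr 2)"
          by (intro AE_I2) simp
      qed simp
      then show ?thesis by (simp add: Lp_def)
    qed
    show "\<forall>\<^sub>F n in sequentially. norm ((\<integral>x. S n x * \<phi> x \<partial>\<nu>) - (\<integral>x. W x * \<phi> x \<partial>\<nu>)) \<le>
        Lp_norm \<nu> 2 (\<lambda>x. S n x - W x) * Lp_norm \<nu> 2 \<phi>"
    proof (intro always_eventually allI)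
      fix n
      have "integrable \<nu> (\<lambda>x. S n x * \<phi> x)"
        using Wterm_int by (simp add: S_def sum_distrib_right)
      then have "(\<integral>x. S n x * \<phi> x \<partial>\<nu>) - (\<integral>x. W x * \<phi> x \<partial>\<nu>) = (\<integral>x. (S n x - W x) * \<phi> x \<partial>\<nu>)"
        using int by (simp add: left_diff_distrib)
      then show "norm ((\<integral>x. S n x * \<phi> x \<partial>\<nu>) - (\<integral>x. W x * \<phi> x \<partial>\<nu>)) \<le>
          Lp_norm \<nu> 2 (\<lambda>x. S n x - W x) * Lp_norm \<nu> 2 \<phi>"
        using hoelder_inequality(2)[OF _ _ _ S2 \<phi>Lp[of 2], of n] by simp
    qed
    have "(\<lambda>n. Lp_norm \<nu> 2 (\<lambda>x. S n x - W x)) \<longlonglongrightarrow> 0"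
      using W by (simp add: is_W_def Lp_sums_def S_def)
    then show "(\<lambda>n. Lp_norm \<nu> 2 (\<lambda>x. S n x - W x) * Lp_norm \<nu> 2 \<phi>) \<longlonglongrightarrow> 0"
      by (rule tendsto_mult_left_zero)
  qed
  show "(\<integral>x. diag_op e qhalf (grad \<phi> x) \<bullet> z \<partial>\<nu>) = (\<integral>x. W x * \<phi> x \<partial>\<nu>)"
    unfolding adj using LIMSEQ_unique[OF lim1[unfolded partial] lim2] .
qed

end

theorem proposition7p1:
  fixes m :: real and \<mu> :: "nat \<Rightarrow> real"
    and e :: "nat \<Rightarrow> 'a::{real_inner,banach,second_countable_topology}"
    and z :: 'a
  assumes "m \<ge> 1"
    and "orthonormal_basis e"
    and "\<And>h. \<mu> h > 0"
    and "summable (\<lambda>h. \<mu> h powr (1 / m))"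
  defines "\<nu> \<equiv> nu m \<mu> e"
  defines "Qhalf \<equiv> op_sqrt (covariance_op \<nu>)"
  shows "(\<exists>W. is_W m \<mu> e z W) \<and>
    (\<forall>W. is_W m \<mu> e z W \<longrightarrow>
      (\<forall>\<phi>\<in>Cb1.
         integrable \<nu> (\<lambda>x. Qhalf (grad \<phi> x) \<bullet> z) \<and>
         integrable \<nu> (\<lambda>x. W x * \<phi> x) \<and>
         (\<integral>x. Qhalf (grad \<phi> x) \<bullet> z \<partial>\<nu>) = (\<integral>x. W x * \<phi> x \<partial>\<nu>)) \<and>
      (\<forall>p>1. \<forall>\<phi>\<in>Cb1.
         \<bar>\<integral>x. Qhalf (grad \<phi> x) \<bullet> z \<partial>\<nu>\<bar> \<le> Lp_norm \<nu> (p / (p - 1)) W * Lp_norm \<nu> p \<phi>))"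
proof -
  interpret hilbert_product_measure m \<mu> e
    using assms(1-4) by unfold_locales
  show ?thesis
    unfolding Qhalf_def \<nu>_def op_sqrt_covariance_op
  proof (intro conjI allI impI ballI)
    show "\<exists>W. is_W m \<mu> e z W" by (rule ex_is_W)
  next
    fix W and \<phi> :: "'a \<Rightarrow> real" assume "is_W m \<mu> e z W" "\<phi> \<in> Cb1"
    note parts = integration_by_parts[OF this(2,1)]
    show "integrable (nu m \<mu> e) (\<lambda>x. diag_op e qhalf (grad \<phi> x) \<bullet> z)"
      and "integrable (nu m \<mu> e) (\<lambda>x. W x * \<phi> x)"
      and "(\<integral>x. diag_op e qhalf (grad \<phi> x) \<bullet> z \<partial>nu m \<mu> e) = (\<integral>x. W x * \<phi> x \<partial>nu m \<mu> e)"
      by (fact parts)+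
    fix p :: real assume "p > 1"
    then show "\<bar>\<integral>x. diag_op e qhalf (grad \<phi> x) \<bullet> z \<partial>nu m \<mu> e\<bar> \<le>
        Lp_norm (nu m \<mu> e) (p / (p - 1)) W * Lp_norm (nu m \<mu> e) p \<phi>"
      unfolding parts(3) by (rule parts(4))
  qed
qed

end
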